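(* Let $0<\sigma_{\min}<\sigma_{\max}$, $\Theta=\Omega\times[\sigma_{\min},\sigma_{\max}]$, and let the feature parameters $(\boldsymbol c_j,\sigma_j)_{j\ge1}$ be independent and identically distributed from a probability measure having full support on $\Theta$. For $M\ge1$ let $V_M^{\mathrm{RF}}=\mathrm{span}\{\varphi_1,\dots,\varphi_M\}$. (1) If $\Omega\subset\mathbb R^d$ is the closure of a bounded domain with nonempty interior and $\varphi_j(\boldsymbol x)=\exp\left(-\frac{\|\boldsymbol x-\boldsymbol c_j\|^2}{2\sigma_j^2}\right)$, then almost surely $$\overline{\bigcup_{M\ge1}V_M^{\mathrm{RF}}}^{\,C(\Omega)}=C(\Omega),$$ and the same union is almost surely dense in $L^2(\Omega)$. (2) If instead $\Omega=\prod_{\ell=1}^d[a_\ell,a_\ell+L_\ell)$ is a periodic rectangular cell and $$\varphi_j(\boldsymbol x)=\sum_{\boldsymbol k\in\mathbb Z^d}\exp\left(-\frac{\|\boldsymbol x-\boldsymbol c_j+\boldsymbol k\odot\boldsymbol L\|^2}{2\sigma_j^2}\right),\qquad \boldsymbol L=(L_1,\dots,L_d),$$ then almost surely $$\overline{\bigcup_{M\ge1}V_M^{\mathrm{RF}}}^{\,C_{\mathrm{per}}(\overline\Omega)}=C_{\mathrm{per}}(\overline\Omega),$$ and the same union is almost surely dense in $L^2_{\mathrm{per}}(\Omega)$.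
   Context: $C(\Omega)$ carries the sup norm. $C_{\mathrm{per}}(\overline\Omega)$ is the space of continuous functions on $\overline\Omega$ that are periodic with periods $L_\ell$ in each coordinate (equivalently continuous functions on the torus obtained by identifying opposite faces), with the sup norm; $L^2_{\mathrm{per}}(\Omega)$ is the corresponding $L^2$ space. In the periodic case the cell $\Omega$ is regarded as this torus. $\odot$ denotes the componentwise product. A measure has full support on $\Theta$ if every nonempty open subset of $\Theta$ has positive measure. An overline with a superscript space denotes closure in the norm of that space. *)

theory Defs
  imports "HOL-Probability.Probability" "HOL-Library.Function_Algebras"
begin

definition gaussian_feature :: "(real ^ 'n) \<times> real \<Rightarrow> real ^ 'n \<Rightarrow> real" where
  "gaussian_feature \<theta> x = exp (- (norm (x - fst \<theta>))\<^sup>2 / (2 * (snd \<theta>)\<^sup>2))"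

definition periodic_gaussian_feature ::
  "real ^ 'n \<Rightarrow> (real ^ 'n) \<times> real \<Rightarrow> real ^ 'n \<Rightarrow> real" where
  "periodic_gaussian_feature L \<theta> x =
     (\<Sum>\<^sub>\<infinity>k::int ^ 'n.
        exp (- (norm (x - fst \<theta> + (\<chi> l. of_int (k $ l) * L $ l)))\<^sup>2 / (2 * (snd \<theta>)\<^sup>2)))"

text \<open>
  Real functions on a type form a real vector space with the pointwise operations; its span is
  the library's \<^const>\<open>module.span\<close> at pointwise scaling.
\<close>

abbreviation (input) fun_scale :: "real \<Rightarrow> ('a \<Rightarrow> real) \<Rightarrow> 'a \<Rightarrow> real" where
  "fun_scale c f \<equiv> (\<lambda>x. c * f x)"

lemma vector_space_fun_scale: "vector_space fun_scale"
  by unfold_locales (auto simp: fun_eq_iff algebra_simps)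

definition V_RF :: "(nat \<Rightarrow> 'a \<Rightarrow> real) \<Rightarrow> nat \<Rightarrow> ('a \<Rightarrow> real) set" where
  "V_RF \<phi> M = module.span fun_scale (\<phi> ` {1..M})"

text \<open>
  Elements of \<^const>\<open>cfunspace\<close> are extensional functions, so functions on the whole space enter
  through their restrictions.
\<close>

definition sup_closure :: "'a set \<Rightarrow> ('a \<Rightarrow> real) metric \<Rightarrow> ('a \<Rightarrow> real) set \<Rightarrow> ('a \<Rightarrow> real) set" where
  "sup_closure S C F = mtopology_of C closure_of ((\<lambda>f. restrict f S) ` F)"

definition C_space :: "'a::topological_space set \<Rightarrow> ('a \<Rightarrow> real) metric" where
  "C_space S = cfunspace (top_of_set S) euclidean_metric"

definition cell :: "real ^ 'n \<Rightarrow> real ^ 'n \<Rightarrow> (real ^ 'n) set" where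
  "cell a L = {x. \<forall>l. a $ l \<le> x $ l \<and> x $ l < a $ l + L $ l}"

definition C_per :: "real ^ 'n \<Rightarrow> real ^ 'n \<Rightarrow> (real ^ 'n \<Rightarrow> real) metric" where
  "C_per a L = submetric (C_space (closure (cell a L)))
     {f. \<forall>x l. x \<in> closure (cell a L) \<longrightarrow> x + axis l (L $ l) \<in> closure (cell a L)
            \<longrightarrow> f (x + axis l (L $ l)) = f x}"

text \<open>
  The topology of the torus carried over to the half-open cell: the quotient topology of the map
  sending a point to its representative in the cell modulo the period lattice.
\<close>

definition wrap :: "real ^ 'n \<Rightarrow> real ^ 'n \<Rightarrow> real ^ 'n \<Rightarrow> real ^ 'n" where
  "wrap a L x = (\<chi> l. a $ l + L $ l * frac ((x $ l - a $ l) / L $ l))"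

definition torus_topology :: "real ^ 'n \<Rightarrow> real ^ 'n \<Rightarrow> (real ^ 'n) topology" where
  "torus_topology a L = topology (\<lambda>U. U \<subseteq> cell a L \<and> open (wrap a L -` U))"

lemma openin_torus_topology:
  "openin (torus_topology a L) U \<longleftrightarrow> U \<subseteq> cell a L \<and> open (wrap a L -` U)"
proof -
  have "istopology (\<lambda>U. U \<subseteq> cell a L \<and> open (wrap a L -` U))"
    unfolding istopology_def by (auto simp: vimage_Union)
  then show ?thesis
    by (simp add: torus_topology_def)
qed

lemma wrap_in_cell: "wrap a L x \<in> cell a L" if "\<And>l. 0 < L $ l"
  using that by (simp add: wrap_def cell_def frac_lt_1 less_imp_le)

lemma wrap_cong_lattice: "\<exists>k :: int ^ 'n. wrap a L x = x + (\<chi> l. of_int (k $ l) * L $ l)"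
  if "\<And>l. 0 < L $ l" for a L x :: "real ^ 'n"
proof
  have "a $ l + L $ l * frac ((x $ l - a $ l) / L $ l)
      = x $ l + of_int (- \<lfloor>(x $ l - a $ l) / L $ l\<rfloor>) * L $ l" for l
    using that[of l] by (simp add: frac_def field_simps)
  then show "wrap a L x = x + (\<chi> l. of_int ((\<chi> l. - \<lfloor>(x $ l - a $ l) / L $ l\<rfloor>) $ l) * L $ l)"
    by (simp add: wrap_def vec_eq_iff)
qed

lemma topspace_torus_topology: "topspace (torus_topology a L) = cell a L" if "\<And>l. 0 < L $ l"
proof -
  have "wrap a L -` cell a L = UNIV"
    using wrap_in_cell[OF that] by auto
  then have "openin (torus_topology a L) (cell a L)"
    by (simp add: openin_torus_topology)
  then show ?thesis
    by (meson openin_subset openin_topspace openin_torus_topology subset_antisym)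
qed

text \<open>Borel probability measures on a topological space that charge every nonempty open set.\<close>

definition full_support_prob :: "'a topology \<Rightarrow> 'a measure \<Rightarrow> bool" where
  "full_support_prob T \<nu> \<longleftrightarrow>
     prob_space \<nu> \<and> space \<nu> = topspace T \<and> sets \<nu> = sigma_sets (topspace T) {U. openin T U} \<and>
     (\<forall>U. openin T U \<longrightarrow> U \<noteq> {} \<longrightarrow> 0 < emeasure \<nu> U)"

definition iid_samples :: "'w measure \<Rightarrow> 'a measure \<Rightarrow> (nat \<Rightarrow> 'w \<Rightarrow> 'a) \<Rightarrow> bool" where
  "iid_samples P \<nu> X \<longleftrightarrow>
     prob_space.indep_vars P (\<lambda>_. \<nu>) X {1..} \<and> (\<forall>j\<ge>1. distr P \<nu> (X j) = \<nu>)"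

text \<open>
  $L^2$ is represented by square-integrable functions rather than by their classes modulo
  almost-everywhere equality; density does not depend on this choice.
\<close>

definition L2_space :: "'a measure \<Rightarrow> ('a \<Rightarrow> real) set" where
  "L2_space M = {f. f \<in> borel_measurable M \<and> integrable M (\<lambda>x. (f x)\<^sup>2)}"

definition L2_dist :: "'a measure \<Rightarrow> ('a \<Rightarrow> real) \<Rightarrow> ('a \<Rightarrow> real) \<Rightarrow> real" where
  "L2_dist M f g = sqrt (integral\<^sup>L M (\<lambda>x. (f x - g x)\<^sup>2))"

definition L2_dense :: "'a measure \<Rightarrow> ('a \<Rightarrow> real) set \<Rightarrow> bool" where
  "L2_dense M F \<longleftrightarrow>
     F \<subseteq> L2_space M \<and> (\<forall>f\<in>L2_space M. \<forall>\<epsilon>>0. \<exists>g\<in>F. L2_dist M f g < \<epsilon>)"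

end

theory Submission
  imports Defs
begin

text \<open>
  Both cases are instances of one family of features. For a set \<open>K\<close> of integer vectors, put
  \<open>\<Phi>\<^bsub>c,\<sigma>\<^esub>(x) = (\<Sum>k\<in>K. exp (- |x - c + kL|\<^sup>2 / 2\<sigma>\<^sup>2))\<close>, where \<open>kL\<close> has the components \<open>k\<^sub>l L\<^sub>l\<close>.
  The choice \<open>K = {0}\<close> gives the plain Gaussian features and \<open>K = \<int>\<^sup>n\<close> the periodic ones.

  Probability enters only once. A nonempty open set of parameters has positive probability, so
  almost surely it is hit; running through a countable basis, almost surely every nonempty open set of
  parameters in the interior of \<open>\<Theta>\<close> is hit (\<open>iid_hits_every_open\<close>). As \<open>\<Phi>\<^bsub>c,\<sigma>\<^esub>\<close> depends
  continuously on \<open>(c, \<sigma>)\<close>, uniformly in \<open>x\<close>, the uniform closure \<open>W\<close> of the span of the sampled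
  features then contains \<open>\<Phi>\<^bsub>c,\<sigma>\<^esub>\<close> for every interior \<open>(c, \<sigma>)\<close>. What remains is deterministic.

  Fix an interior parameter \<open>(c, \<sigma>)\<close> and write \<open>y\<^sub>k = x - c + kL\<close>. Completing the square shows that,
  up to a constant factor, moving the centre from \<open>c\<close> to \<open>c + t\<sigma>\<^sup>2v\<close> multiplies the \<open>k\<close>-th summand by
  \<open>exp (t v \<bullet> y\<^sub>k)\<close>. Hence \<open>W\<close> contains \<open>(\<Sum>k\<in>K. exp (- |y\<^sub>k|\<^sup>2 / 2\<sigma>\<^sup>2) * exp (t v \<bullet> y\<^sub>k))\<close> for all
  small real \<open>t\<close>. This is analytic in \<open>t\<close>, so its Taylor coefficients at \<open>0\<close> lie in \<open>W\<close>, and summing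
  them with other coefficients continues it to imaginary \<open>t\<close>: the exponential may be replaced by
  \<open>cos (v \<bullet> y\<^sub>k + p)\<close> (\<open>cos_in_closure\<close>). If \<open>v\<close> lies in the dual lattice, then this cosine is the same
  for all \<open>k\<close> and can be taken out of the sum: \<open>W\<close> contains \<open>\<Phi>\<^bsub>c,\<sigma>\<^esub>(x) cos (v \<bullet> x + p)\<close>
  (\<open>gauss_modulated_in_closure\<close>). No Fourier coefficient of a theta function has to be computed.

  By the Stone--Weierstrass theorem the waves \<open>cos (v \<bullet> x + p)\<close> span a uniformly dense set of
  continuous functions (for \<open>K = {0}\<close>) or of continuous periodic functions (for \<open>K = \<int>\<^sup>n\<close>). Since
  \<open>\<Phi>\<^bsub>c,\<sigma>\<^esub>\<close> is continuous and positive, applying this to \<open>f / \<Phi>\<^bsub>c,\<sigma>\<^esub>\<close> puts every admissible \<open>f\<close> into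
  \<open>W\<close> (\<open>lattice_gauss_span_dense\<close>).

  Density in the square mean follows because continuous functions are dense there; in the periodic
  case they are first multiplied by cutoffs that vanish on the boundary of the cell, which makes them
  periodic (\<open>L2_dense_of_uniform_closure\<close>).
\<close>

section \<open>Uniform closure of linear families of functions\<close>

definition uniform_closure :: "'a set \<Rightarrow> ('a \<Rightarrow> real) set \<Rightarrow> ('a \<Rightarrow> real) set" where
  "uniform_closure S F = {f. \<forall>e>0. \<exists>g\<in>F. \<forall>x\<in>S. \<bar>f x - g x\<bar> < e}"

definition lincomb_closed :: "('a \<Rightarrow> real) set \<Rightarrow> bool" where
  "lincomb_closed F \<longleftrightarrow> F \<noteq> {} \<and> (\<forall>f\<in>F. \<forall>g\<in>F. \<forall>a b. (\<lambda>x. a * f x + b * g x) \<in> F)"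

lemma uniform_closureD:
  assumes "f \<in> uniform_closure S F" "e > 0"
  obtains g where "g \<in> F" "\<And>x. x \<in> S \<Longrightarrow> \<bar>f x - g x\<bar> < e"
  using assms unfolding uniform_closure_def by blast

lemma subset_uniform_closure: "F \<subseteq> uniform_closure S F"
  unfolding uniform_closure_def by force

lemma uniform_closure_limit:
  assumes "\<And>e. e > 0 \<Longrightarrow> \<exists>g\<in>uniform_closure S F. \<forall>x\<in>S. \<bar>f x - g x\<bar> \<le> e"
  shows "f \<in> uniform_closure S F"
  unfolding uniform_closure_def
proof safe
  fix e :: real assume "e > 0"
  then obtain g where g: "g \<in> uniform_closure S F" "\<forall>x\<in>S. \<bar>f x - g x\<bar> \<le> e/2"
    using assms[of "e/2"] by auto
  obtain h where h: "h \<in> F" "\<And>x. x \<in> S \<Longrightarrow> \<bar>g x - h x\<bar> < e/2"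
    using uniform_closureD[OF g(1), of "e/2"] \<open>e > 0\<close> by auto
  have "\<bar>f x - h x\<bar> < e" if "x \<in> S" for x
  proof -
    have "\<bar>f x - g x\<bar> \<le> e/2" "\<bar>g x - h x\<bar> < e/2" using g(2) h(2) that by auto
    then show ?thesis by linarith
  qed
  with h(1) show "\<exists>g\<in>F. \<forall>x\<in>S. \<bar>f x - g x\<bar> < e" by blast
qed

lemma uniform_closure_cong:
  assumes "f \<in> uniform_closure S F" "\<And>x. x \<in> S \<Longrightarrow> f x = g x"
  shows "g \<in> uniform_closure S F"
  using assms unfolding uniform_closure_def by simp

lemma uniform_closure_lincomb:
  assumes F: "lincomb_closed F" and "f \<in> uniform_closure S F" "g \<in> uniform_closure S F"
  shows "(\<lambda>x. a * f x + b * g x) \<in> uniform_closure S F"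
proof (rule uniform_closure_limit)
  fix e :: real assume "e > 0"
  define d where "d = e / (\<bar>a\<bar> + \<bar>b\<bar> + 1)"
  have d: "d > 0" using \<open>e > 0\<close> by (auto simp: d_def intro!: divide_pos_pos)
  obtain f' where f': "f' \<in> F" "\<And>x. x \<in> S \<Longrightarrow> \<bar>f x - f' x\<bar> < d"
    using uniform_closureD[OF assms(2) d] by metis
  obtain g' where g': "g' \<in> F" "\<And>x. x \<in> S \<Longrightarrow> \<bar>g x - g' x\<bar> < d"
    using uniform_closureD[OF assms(3) d] by metis
  have "\<bar>(a * f x + b * g x) - (a * f' x + b * g' x)\<bar> \<le> e" if "x \<in> S" for x
  proof -
    have "\<bar>(a * f x + b * g x) - (a * f' x + b * g' x)\<bar> = \<bar>a * (f x - f' x) + b * (g x - g' x)\<bar>"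
      by (simp add: algebra_simps)
    also have "\<dots> \<le> \<bar>a\<bar> * \<bar>f x - f' x\<bar> + \<bar>b\<bar> * \<bar>g x - g' x\<bar>"
      by (metis abs_mult abs_triangle_ineq)
    also have "\<dots> \<le> \<bar>a\<bar> * d + \<bar>b\<bar> * d"
      using f'(2)[OF that] g'(2)[OF that] by (intro add_mono mult_left_mono) auto
    also have "\<dots> \<le> (\<bar>a\<bar> + \<bar>b\<bar> + 1) * d"
      using d by (simp add: algebra_simps)
    also have "\<dots> = e" by (simp add: d_def add_nonneg_eq_0_iff)
    finally show ?thesis .
  qed
  moreover have "(\<lambda>x. a * f' x + b * g' x) \<in> uniform_closure S F"
    using F f'(1) g'(1) subset_uniform_closure unfolding lincomb_closed_def by blast
  ultimately show "\<exists>g'\<in>uniform_closure S F. \<forall>x\<in>S. \<bar>a * f x + b * g x - g' x\<bar> \<le> e"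
    by (intro bexI[where x = "\<lambda>x. a * f' x + b * g' x"]) auto
qed

text \<open>
  Multiplication by a bounded \<open>\<Phi>\<close> is uniformly continuous, so it is enough to know its effect on the
  dense family \<open>A\<close>. This is how density of the waves is transported to density of \<open>\<Phi>\<close> times the waves.
\<close>

lemma uniform_closure_mult_bounded:
  assumes bd: "\<And>x. x \<in> S \<Longrightarrow> \<bar>\<Phi> x\<bar> \<le> B"
    and A: "\<And>u. u \<in> A \<Longrightarrow> (\<lambda>x. \<Phi> x * u x) \<in> uniform_closure S F"
    and f: "f \<in> uniform_closure S A"
  shows "(\<lambda>x. \<Phi> x * f x) \<in> uniform_closure S F"
proof (rule uniform_closure_limit)
  fix e :: real assume "e > 0"
  define d where "d = e / (\<bar>B\<bar> + 1)"
  have d: "d > 0" using \<open>e > 0\<close> by (auto simp: d_def)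
  obtain u where u: "u \<in> A" "\<And>x. x \<in> S \<Longrightarrow> \<bar>f x - u x\<bar> < d"
    using uniform_closureD[OF f d] by metis
  have "\<bar>\<Phi> x * f x - \<Phi> x * u x\<bar> \<le> e" if "x \<in> S" for x
  proof -
    have "\<bar>\<Phi> x * f x - \<Phi> x * u x\<bar> = \<bar>\<Phi> x\<bar> * \<bar>f x - u x\<bar>"
      by (metis abs_mult right_diff_distrib)
    also have "\<dots> \<le> (\<bar>B\<bar> + 1) * d"
      using bd[OF that] u(2)[OF that] by (intro mult_mono) auto
    also have "\<dots> = e" by (simp add: d_def)
    finally show ?thesis .
  qed
  then show "\<exists>g\<in>uniform_closure S F. \<forall>x\<in>S. \<bar>\<Phi> x * f x - g x\<bar> \<le> e"
    by (intro bexI[OF _ A[OF u(1)]]) auto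
qed


section \<open>From real exponentials near zero to cosines\<close>

lemma power_le_fact_exp: "x \<ge> 0 \<Longrightarrow> x ^ n \<le> fact n * exp (x::real)"
proof -
  assume x: "x \<ge> 0"
  obtain t where t: "exp x = (\<Sum>m<Suc n. x ^ m / fact m) + exp t / fact (Suc n) * x ^ Suc n"
    using Maclaurin_exp_le[of x "Suc n"] by blast
  have "x ^ n / fact n \<le> exp x"
    unfolding t using x by (auto intro!: add_nonneg_nonneg sum_nonneg simp: lessThan_Suc)
  then show ?thesis by (simp add: field_simps)
qed

lemma abs_exp_minus_linear_le: "\<bar>exp u - 1 - u\<bar> \<le> u\<^sup>2 * exp \<bar>u::real\<bar>"
proof -
  obtain t where t: "\<bar>t\<bar> \<le> \<bar>u\<bar>" "exp u = (\<Sum>m<2. u ^ m / fact m) + exp t / fact 2 * u ^ 2"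
    using Maclaurin_exp_le[of u 2] by blast
  have "\<bar>exp u - 1 - u\<bar> = exp t / 2 * u\<^sup>2"
    unfolding t(2) by (simp add: numeral_2_eq_2 abs_mult)
  also have "\<dots> \<le> exp \<bar>u\<bar> * u\<^sup>2"
  proof (rule mult_right_mono)
    have "exp t \<le> exp \<bar>u\<bar>" "0 < exp t" using t(1) by auto
    then show "exp t / 2 \<le> exp \<bar>u\<bar>" by linarith
  qed simp
  finally show ?thesis by (simp add: mult.commute)
qed

text \<open>
  The rate \<open>3\<close> leaves room for one derivative step: \<open>s\<^sup>m exp (t s)\<close> with \<open>|t| \<le> 1\<close> costs a rate of \<open>2\<close>,
  and the error of a difference quotient costs one more.
\<close>

definition exp_growth :: "(real \<Rightarrow> real) \<Rightarrow> bool" where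
  "exp_growth q \<longleftrightarrow> (\<exists>C\<ge>0. \<forall>s. \<bar>q s\<bar> \<le> C * exp (3 * \<bar>s\<bar>))"

lemma exp_growthI:
  assumes "\<And>s. \<bar>q s\<bar> \<le> C * exp (3 * \<bar>s\<bar>)"
  shows "exp_growth q"
proof -
  have "C \<ge> 0" using assms[of 0] by auto
  then show ?thesis using assms exp_growth_def by blast
qed

lemma exp_growth_lincomb:
  assumes "exp_growth q" "exp_growth r"
  shows "exp_growth (\<lambda>s. a * q s + b * r s)"
proof -
  obtain C D where C: "\<And>s. \<bar>q s\<bar> \<le> C * exp (3 * \<bar>s\<bar>)" and D: "\<And>s. \<bar>r s\<bar> \<le> D * exp (3 * \<bar>s\<bar>)"
    using assms unfolding exp_growth_def by blast
  show ?thesis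
  proof (rule exp_growthI[where C = "\<bar>a\<bar> * C + \<bar>b\<bar> * D"])
    fix s
    have "\<bar>a * q s + b * r s\<bar> \<le> \<bar>a\<bar> * \<bar>q s\<bar> + \<bar>b\<bar> * \<bar>r s\<bar>"
      by (metis abs_mult abs_triangle_ineq)
    also have "\<dots> \<le> \<bar>a\<bar> * (C * exp (3 * \<bar>s\<bar>)) + \<bar>b\<bar> * (D * exp (3 * \<bar>s\<bar>))"
      by (intro add_mono mult_left_mono C D) auto
    finally show "\<bar>a * q s + b * r s\<bar> \<le> (\<bar>a\<bar> * C + \<bar>b\<bar> * D) * exp (3 * \<bar>s\<bar>)"
      by (simp add: algebra_simps)
  qed
qed

lemma power_exp_bound:
  assumes "\<bar>t\<bar> \<le> 1"
  shows "\<bar>s ^ m * exp (t * s)\<bar> \<le> fact m * exp (2 * \<bar>s::real\<bar>)"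
proof -
  have "\<bar>t\<bar> * \<bar>s\<bar> \<le> 1 * \<bar>s\<bar>" using assms by (intro mult_right_mono) auto
  then have ts: "t * s \<le> \<bar>s\<bar>" by (metis abs_le_D1 abs_mult mult_1)
  have "\<bar>s ^ m * exp (t * s)\<bar> = \<bar>s\<bar> ^ m * exp (t * s)" by (simp add: abs_mult power_abs)
  also have "\<dots> \<le> (fact m * exp \<bar>s\<bar>) * exp \<bar>s\<bar>"
    using ts by (intro mult_mono power_le_fact_exp) auto
  also have "\<dots> = fact m * exp (2 * \<bar>s\<bar>)" by (simp add: mult_exp_exp)
  finally show ?thesis .
qed

lemma exp_growth_power_exp:
  assumes "\<bar>t\<bar> \<le> 1"
  shows "exp_growth (\<lambda>s. s ^ m * exp (t * s))"
proof (rule exp_growthI[where C = "fact m"])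
  fix s
  have "\<bar>s ^ m * exp (t * s)\<bar> \<le> fact m * exp (2 * \<bar>s\<bar>)" by (rule power_exp_bound[OF assms])
  also have "\<dots> \<le> fact m * exp (3 * \<bar>s\<bar>)" by simp
  finally show "\<bar>s ^ m * exp (t * s)\<bar> \<le> fact m * exp (3 * \<bar>s\<bar>)" .
qed

text \<open>
  \<open>T q\<close> stands for a superposition \<open>x \<mapsto> (\<Sum>k. w\<^sub>k(x) q(s\<^sub>k(x)))\<close> whose positive weights absorb
  \<open>exp (3 |s\<^sub>k(x)|)\<close>, with a total of at most \<open>B\<close>. Only linearity and this bound are used, so the
  analytic continuation below takes place entirely on functions \<open>q\<close> of one real variable.
\<close>

locale bounded_superposition =
  fixes T :: "(real \<Rightarrow> real) \<Rightarrow> 'a \<Rightarrow> real" and S :: "'a set" and B :: real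
  assumes lincomb: "\<And>q r a b x. exp_growth q \<Longrightarrow> exp_growth r \<Longrightarrow> x \<in> S \<Longrightarrow>
      T (\<lambda>s. a * q s + b * r s) x = a * T q x + b * T r x"
    and bound: "\<And>q C x. \<lbrakk>\<And>s. \<bar>q s\<bar> \<le> C * exp (3 * \<bar>s\<bar>); x \<in> S\<rbrakk> \<Longrightarrow> \<bar>T q x\<bar> \<le> C * B"
begin

lemma limit:
  assumes q: "exp_growth q"
    and appr: "\<And>e. e > 0 \<Longrightarrow> \<exists>r. exp_growth r \<and> T r \<in> uniform_closure S F \<and>
        (\<forall>s. \<bar>q s - r s\<bar> \<le> e * exp (3 * \<bar>s\<bar>))"
  shows "T q \<in> uniform_closure S F"
proof (rule uniform_closure_limit)
  fix e :: real assume "e > 0"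
  define d where "d = e / (\<bar>B\<bar> + 1)"
  have d: "d > 0" using \<open>e > 0\<close> by (auto simp: d_def)
  obtain r where r: "exp_growth r" "T r \<in> uniform_closure S F"
      "\<And>s. \<bar>q s - r s\<bar> \<le> d * exp (3 * \<bar>s\<bar>)"
    using appr[OF d] by blast
  have "\<bar>T q x - T r x\<bar> \<le> e" if x: "x \<in> S" for x
  proof -
    have "T q x - T r x = T (\<lambda>s. 1 * q s + (-1) * r s) x"
      using lincomb[OF q r(1) x, of 1 "-1"] by simp
    also have "\<bar>\<dots>\<bar> \<le> d * B"
      using r(3) by (intro bound[OF _ x]) simp
    also have "\<dots> \<le> d * (\<bar>B\<bar> + 1)"
      using d by (intro mult_left_mono) auto
    also have "\<dots> = e" by (simp add: d_def)
    finally show ?thesis .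
  qed
  with r(2) show "\<exists>g\<in>uniform_closure S F. \<forall>x\<in>S. \<bar>T q x - g x\<bar> \<le> e" by blast
qed

lemma lincomb_in_closure:
  assumes "lincomb_closed F" "exp_growth q" "exp_growth r"
    "T q \<in> uniform_closure S F" "T r \<in> uniform_closure S F"
  shows "T (\<lambda>s. a * q s + b * r s) \<in> uniform_closure S F"
  by (rule uniform_closure_cong[OF uniform_closure_lincomb[OF assms(1,4,5)]])
     (simp add: lincomb[OF assms(2,3)])

text \<open>
  Differentiating \<open>exp (t s)\<close> in \<open>t\<close> produces one factor \<open>s\<close>. The difference quotients are linear
  combinations of members of the family, and they converge at the weighted rate that \<open>limit\<close> asks for.
\<close>

lemma power_exp_in_closure:
  assumes F: "lincomb_closed F" and \<delta>: "0 < \<delta>" "\<delta> \<le> 1"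
    and fam: "\<And>t. \<bar>t\<bar> < \<delta> \<Longrightarrow> T (\<lambda>s. exp (t * s)) \<in> uniform_closure S F"
  shows "\<bar>t\<bar> < \<delta> \<Longrightarrow> T (\<lambda>s. s ^ m * exp (t * s)) \<in> uniform_closure S F"
proof (induction m arbitrary: t)
  case 0
  then show ?case using fam by simp
next
  case (Suc m)
  show ?case
  proof (rule limit)
    show "exp_growth (\<lambda>s. s ^ Suc m * exp (t * s))"
      using Suc.prems \<delta> by (intro exp_growth_power_exp) auto
    fix e :: real assume "e > 0"
    define d where "d = e / fact (m + 2)"
    have d: "d > 0" using \<open>e > 0\<close> by (simp add: d_def del: fact_Suc add_2_eq_Suc')
    define h where "h = min ((\<delta> - \<bar>t\<bar>) / 2) d"
    have h: "h > 0" "h < \<delta> - \<bar>t\<bar>" "h \<le> d" "h \<le> 1"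
      using Suc.prems d \<delta> unfolding h_def by (auto simp: min_def)
    have th: "\<bar>t + h\<bar> < \<delta>" "\<bar>t\<bar> < \<delta>" using h Suc.prems by auto
    define r where "r s = (1/h) * (s ^ m * exp ((t + h) * s)) + (-(1/h)) * (s ^ m * exp (t * s))" for s :: real
    have "exp_growth r"
      unfolding r_def
      by (rule exp_growth_lincomb[of "\<lambda>s. s ^ m * exp ((t + h) * s)" "\<lambda>s. s ^ m * exp (t * s)"])
         (use th \<delta> in \<open>auto intro: exp_growth_power_exp\<close>)
    moreover have "T r \<in> uniform_closure S F"
    proof -
      have "T (\<lambda>s. (1/h) * (s ^ m * exp ((t + h) * s)) + (-(1/h)) * (s ^ m * exp (t * s))) \<in> uniform_closure S F"
        by (rule lincomb_in_closure[OF F, of "\<lambda>s. s ^ m * exp ((t + h) * s)" "\<lambda>s. s ^ m * exp (t * s)"])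
           (use th \<delta> Suc.IH in \<open>auto intro: exp_growth_power_exp\<close>)
      then show ?thesis by (simp add: r_def[abs_def])
    qed
    moreover have "\<bar>s ^ Suc m * exp (t * s) - r s\<bar> \<le> e * exp (3 * \<bar>s\<bar>)" for s
    proof -
      have "s ^ Suc m * exp (t * s) - r s = - (s ^ m * exp (t * s)) * ((exp (h * s) - 1 - h * s) / h)"
        using h(1) by (simp add: r_def field_simps exp_add)
      then have "\<bar>s ^ Suc m * exp (t * s) - r s\<bar>
          = \<bar>s ^ m * exp (t * s)\<bar> * (\<bar>exp (h * s) - 1 - h * s\<bar> / h)"
        using h(1) by (simp add: abs_mult abs_divide)
      also have "\<dots> \<le> \<bar>s ^ m * exp (t * s)\<bar> * ((h * s)\<^sup>2 * exp \<bar>h * s\<bar> / h)"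
        using h(1) by (intro mult_left_mono divide_right_mono abs_exp_minus_linear_le) auto
      also have "\<dots> = h * (\<bar>s ^ (m + 2) * exp (t * s)\<bar> * exp \<bar>h * s\<bar>)"
        using h(1) by (simp add: abs_mult power_abs power2_eq_square power_add field_simps)
      also have "\<dots> \<le> h * ((fact (m + 2) * exp (2 * \<bar>s\<bar>)) * exp \<bar>s\<bar>)"
        using h th \<delta> by (intro mult_left_mono mult_mono power_exp_bound) (auto simp: abs_mult mult_left_le_one_le)
      also have "\<dots> = h * fact (m + 2) * exp (3 * \<bar>s\<bar>)"
        by (simp add: mult_exp_exp mult.assoc)
      also have "\<dots> \<le> e * exp (3 * \<bar>s\<bar>)"
        using h(3) unfolding d_def
        by (intro mult_right_mono) (simp_all add: field_simps del: fact_Suc add_2_eq_Suc')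
      finally show ?thesis .
    qed
    ultimately show "\<exists>r. exp_growth r \<and> T r \<in> uniform_closure S F \<and>
        (\<forall>s. \<bar>s ^ Suc m * exp (t * s) - r s\<bar> \<le> e * exp (3 * \<bar>s\<bar>))" by blast
  qed
qed

text \<open>
  At \<open>t = 0\<close> the preceding lemma yields all monomials, hence all polynomials in \<open>s\<close>. The Taylor
  polynomials of the cosine converge in the weighted sense because \<open>|s|\<^sup>n / n! \<le> 2\<^sup>-\<^sup>n exp (2 |s|)\<close>. The
  phase \<open>p\<close> treats sine and cosine at once.
\<close>

lemma cos_in_closure:
  assumes F: "lincomb_closed F" and \<delta>: "0 < \<delta>" "\<delta> \<le> 1"
    and fam: "\<And>t. \<bar>t\<bar> < \<delta> \<Longrightarrow> T (\<lambda>s. exp (t * s)) \<in> uniform_closure S F"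
  shows "T (\<lambda>s. cos (s + p)) \<in> uniform_closure S F"
proof (rule limit)
  show "exp_growth (\<lambda>s. cos (s + p))"
  proof (rule exp_growthI[where C = 1])
    fix s :: real
    have "\<bar>cos (s + p)\<bar> \<le> 1" "1 \<le> exp (3 * \<bar>s\<bar>)" by simp_all
    then show "\<bar>cos (s + p)\<bar> \<le> 1 * exp (3 * \<bar>s\<bar>)" by linarith
  qed
  have pow: "T (\<lambda>s. s ^ m) \<in> uniform_closure S F" "exp_growth (\<lambda>s. s ^ m)" for m
    using power_exp_in_closure[OF F \<delta> fam, of 0 m] exp_growth_power_exp[of 0 m] \<delta> by auto
  fix e :: real assume "e > 0"
  obtain n where n: "(1/2) ^ n < e"
    using real_arch_pow_inv[OF \<open>e > 0\<close>, of "1/2"] by auto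
  define c where "c m = cos (p + real m * (pi/2)) / fact m" for m
  have poly: "exp_growth (\<lambda>s. \<Sum>m<n. c m * s ^ m) \<and> T (\<lambda>s. \<Sum>m<n. c m * s ^ m) \<in> uniform_closure S F" for n
  proof (induction n)
    case 0
    have "T (\<lambda>s. 0 * s ^ 0 + 0 * s ^ 0) \<in> uniform_closure S F" 
      by (rule lincomb_in_closure[OF F pow(2) pow(2) pow(1) pow(1)])
    then show ?case by (auto intro: exp_growthI[where C = 0])
  next
    case (Suc n)
    let ?q = "\<lambda>s. \<Sum>m<n. c m * s ^ m"
    have "exp_growth (\<lambda>s. 1 * ?q s + c n * s ^ n)"
      by (rule exp_growth_lincomb[of ?q "\<lambda>s. s ^ n"]) (use Suc pow in auto)
    moreover have "T (\<lambda>s. 1 * ?q s + c n * s ^ n) \<in> uniform_closure S F"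
      by (rule lincomb_in_closure[OF F, of ?q "\<lambda>s. s ^ n"]) (use Suc pow in auto)
    ultimately show ?case by simp
  qed
  have "\<bar>cos (s + p) - (\<Sum>m<n. c m * s ^ m)\<bar> \<le> e * exp (3 * \<bar>s\<bar>)" for s
  proof -
    define diff where "diff m s = cos (s + p + real m * (pi/2))" for m and s :: real
    have "DERIV (diff m) x :> diff (Suc m) x" for m x
    proof -
      have "cos (x + p + real (Suc m) * (pi/2)) = - sin (x + p + real m * (pi/2))"
        by (simp add: algebra_simps add_divide_distrib cos_add sin_add)
      then show ?thesis
        unfolding diff_def by (auto intro!: derivative_eq_intros)
    qed
    then have "\<exists>t. \<bar>t\<bar> \<le> \<bar>s\<bar> \<and> cos (s + p) = (\<Sum>m<n. (diff m 0 / fact m) * s ^ m) + (diff n t / fact n) * s ^ n"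
      by (intro Maclaurin_all_le) (auto simp: diff_def[of 0])
    then obtain t where t: "cos (s + p) = (\<Sum>m<n. (diff m 0 / fact m) * s ^ m) + (diff n t / fact n) * s ^ n"
      by blast
    have "\<bar>cos (s + p) - (\<Sum>m<n. c m * s ^ m)\<bar> = \<bar>diff n t / fact n * s ^ n\<bar>"
      unfolding t c_def diff_def by simp
    also have "\<dots> \<le> 1 / fact n * \<bar>s\<bar> ^ n"
      unfolding abs_mult abs_divide power_abs diff_def
      by (intro mult_right_mono) (simp_all add: divide_right_mono)
    also have "\<dots> = (1/2) ^ n * ((2 * \<bar>s\<bar>) ^ n / fact n)"
      by (simp add: power_mult_distrib power_divide)
    also have "\<dots> \<le> (1/2) ^ n * exp (2 * \<bar>s\<bar>)"
      using power_le_fact_exp[of "2 * \<bar>s\<bar>" n]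
      by (intro mult_left_mono) (auto simp: field_simps)
    also have "\<dots> \<le> e * exp (3 * \<bar>s\<bar>)"
      using n \<open>e > 0\<close> by (intro mult_mono) auto
    finally show ?thesis .
  qed
  with poly show "\<exists>r. exp_growth r \<and> T r \<in> uniform_closure S F \<and>
        (\<forall>s. \<bar>cos (s + p) - r s\<bar> \<le> e * exp (3 * \<bar>s\<bar>))" by blast
qed

end

section \<open>Lattice sums of Gaussians\<close>

definition lattice_shift :: "real ^ 'n \<Rightarrow> int ^ 'n \<Rightarrow> real ^ 'n" where
  "lattice_shift L k = (\<chi> l. of_int (k $ l) * L $ l)"

definition lattice_sum :: "(int ^ 'n) set \<Rightarrow> real ^ 'n \<Rightarrow> (real ^ 'n \<Rightarrow> real) \<Rightarrow> real ^ 'n \<Rightarrow> real" where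
  "lattice_sum K L q z = (\<Sum>\<^sub>\<infinity>k\<in>K. q (z + lattice_shift L k))"

definition gauss :: "real \<Rightarrow> real ^ 'n \<Rightarrow> real" where
  "gauss \<sigma> y = exp (- (norm y)\<^sup>2 / (2 * \<sigma>\<^sup>2))"

definition lattice_gauss :: "(int ^ 'n) set \<Rightarrow> real ^ 'n \<Rightarrow> (real ^ 'n) \<times> real \<Rightarrow> real ^ 'n \<Rightarrow> real" where
  "lattice_gauss K L \<theta> x = lattice_sum K L (gauss (snd \<theta>)) (x - fst \<theta>)"

lemma lattice_gauss_zero: "lattice_gauss {0} L = gaussian_feature"
  by (simp add: fun_eq_iff lattice_gauss_def lattice_sum_def gauss_def gaussian_feature_def
      lattice_shift_def zero_vec_def[symmetric])

lemma lattice_gauss_UNIV: "lattice_gauss UNIV L = periodic_gaussian_feature L"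
  by (simp add: fun_eq_iff lattice_gauss_def lattice_sum_def gauss_def periodic_gaussian_feature_def
      lattice_shift_def)

lemma lattice_sum_shift:
  "lattice_sum UNIV L q (z + lattice_shift L j) = lattice_sum UNIV L q z"
  unfolding lattice_sum_def
  by (rule infsum_reindex_bij_witness[where i = "\<lambda>k. k - j" and j = "\<lambda>k. k + j"])
     (auto simp: lattice_shift_def vec_eq_iff algebra_simps intro!: arg_cong[where f = q])

text \<open>
  A summable majorant in product form, so that its sum over a box factors into one-dimensional
  geometric sums.
\<close>

definition lattice_decay :: "int ^ 'n \<Rightarrow> real" where
  "lattice_decay k = (\<Prod>l\<in>UNIV. exp (- \<bar>of_int (k $ l)\<bar>))"

lemma sum_exp_neg_abs_int_le:
  "(\<Sum>j\<in>{-int N..int N}. exp (- \<bar>of_int j\<bar>) :: real) \<le> 2 / (1 - exp (-1))"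
proof -
  have half: "(\<Sum>j<Suc N. exp (-1) ^ j :: real) \<le> 1 / (1 - exp (-1))"
    by (subst sum_gp_strict) (simp add: divide_right_mono)
  have eq: "{-int N..int N} \<subseteq> int ` {..<Suc N} \<union> (\<lambda>j. - int j) ` {..<Suc N}"
  proof
    fix j assume "j \<in> {-int N..int N}"
    then have "(j = int (nat j) \<and> nat j \<in> {..<Suc N}) \<or> (j = - int (nat (-j)) \<and> nat (-j) \<in> {..<Suc N})"
      by auto
    then show "j \<in> int ` {..<Suc N} \<union> (\<lambda>j. - int j) ` {..<Suc N}" by blast
  qed
  have "(\<Sum>j\<in>{-int N..int N}. exp (- \<bar>of_int j\<bar>) :: real)
      \<le> (\<Sum>j\<in>int ` {..<Suc N} \<union> (\<lambda>j. - int j) ` {..<Suc N}. exp (- \<bar>of_int j\<bar>))"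
    by (rule sum_mono2[OF _ eq]) auto
  also have "\<dots> \<le> (\<Sum>j\<in>int ` {..<Suc N}. exp (- \<bar>of_int j\<bar>)) + (\<Sum>j\<in>(\<lambda>j. - int j) ` {..<Suc N}. exp (- \<bar>of_int j\<bar>))"
    by (subst sum.union_inter[symmetric]) (auto intro!: sum_nonneg)
  also have "\<dots> = (\<Sum>j<Suc N. exp (-1) ^ j) + (\<Sum>j<Suc N. exp (-1) ^ j)"
    by (subst (1 2) sum.reindex) (auto simp: inj_on_def exp_of_nat_mult[symmetric])
  also have "\<dots> \<le> 2 / (1 - exp (-1))" using half by simp
  finally show ?thesis .
qed

lemma lattice_decay_summable: "(lattice_decay :: int ^ 'n \<Rightarrow> real) summable_on UNIV"
proof (rule nonneg_bounded_partial_sums_imp_summable_on)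
  show "0 \<le> lattice_decay k" for k :: "int ^ 'n"
    by (simp add: lattice_decay_def prod_nonneg)
  define C where "C = (2 / (1 - exp (-1 :: real))) ^ CARD('n)"
  have le: "sum lattice_decay X \<le> C" if "finite X" for X :: "(int ^ 'n) set"
  proof -
    define N where "N = nat (Max (insert 0 ((\<lambda>(k, l). \<bar>k $ l\<bar>) ` (X \<times> UNIV))))"
    have N: "\<bar>k $ l\<bar> \<le> int N" if "k \<in> X" for k l
    proof -
      have "\<bar>k $ l\<bar> \<le> Max (insert 0 ((\<lambda>(k, l). \<bar>k $ l\<bar>) ` (X \<times> UNIV)))"
        using that \<open>finite X\<close> by (intro Max_ge) auto
      also have "\<dots> \<le> int N" unfolding N_def by simp
      finally show ?thesis .
    qed
    let ?B = "PiE (UNIV :: 'n set) (\<lambda>_. {-int N..int N})"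
    have "sum lattice_decay X = (\<Sum>g\<in>vec_nth ` X. \<Prod>l\<in>UNIV. exp (- \<bar>of_int (g l)\<bar>))"
      by (subst sum.reindex) (auto simp: inj_on_def vec_nth_inject lattice_decay_def)
    also have "\<dots> \<le> (\<Sum>g\<in>?B. \<Prod>l\<in>UNIV. exp (- \<bar>of_int (g l)\<bar>))"
    proof (rule sum_mono2)
      show "vec_nth ` X \<subseteq> ?B" using N by (auto simp: abs_le_iff) (smt (verit))+
    qed (auto intro!: finite_PiE prod_nonneg)
    also have "\<dots> = (\<Prod>l\<in>(UNIV :: 'n set). \<Sum>j\<in>{-int N..int N}. exp (- \<bar>of_int j\<bar>))"
      by (subst prod_sum_PiE) auto
    also have "\<dots> \<le> C"
      unfolding C_def prod_constant[symmetric]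
      by (intro prod_mono conjI sum_nonneg sum_exp_neg_abs_int_le) auto
    finally show ?thesis .
  qed
  show "\<forall>\<^sub>F X in finite_subsets_at_top UNIV. sum (lattice_decay :: int ^ 'n \<Rightarrow> real) X \<le> C"
    by (rule eventually_finite_subsets_at_top_weakI) (rule le)
qed

text \<open>
  A Gaussian beats every exponential. For \<open>y = z + kL\<close> with \<open>|z| \<le> R\<close> and \<open>\<eta> = (\<Sum>l. 1 / L\<^sub>l)\<close>, one has
  \<open>(\<Sum>l. |k\<^sub>l|) \<le> \<eta> (|y| + R)\<close>, so that the decay in \<open>k\<close> is paid for by raising the rate from \<open>\<rho>\<close> to \<open>\<rho> + \<eta>\<close>.
  The constant is uniform in \<open>z\<close> and \<open>\<sigma>\<close>; this serves both the summability of the weighted sums and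
  the continuity of the features in their parameters.
\<close>

lemma gauss_lattice_majorant:
  fixes L :: "real ^ 'n"
  assumes L: "\<And>l. 0 < L $ l" and "0 < s"
  obtains A where "0 < A" "\<And>z \<sigma> k. norm z \<le> R \<Longrightarrow> 0 < \<sigma> \<Longrightarrow> \<sigma> \<le> s \<Longrightarrow>
     gauss \<sigma> (z + lattice_shift L k) * exp (\<rho> * norm (z + lattice_shift L k)) \<le> A * lattice_decay k"
proof
  \<comment> \<open>With \<open>\<rho>' = \<rho> + \<eta>\<close> the constant comes from \<open>\<rho>' |y| - |y|\<^sup>2 / 2s\<^sup>2 \<le> \<rho>'\<^sup>2 s\<^sup>2 / 2\<close>.\<close>
  define \<eta> where "\<eta> = (\<Sum>l\<in>UNIV. 1 / L $ l)"
  define A where "A = exp ((\<rho> + \<eta>)\<^sup>2 * s\<^sup>2 / 2 + \<eta> * R)"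
  show "0 < A" by (simp add: A_def)
  fix z :: "real ^ 'n" and \<sigma> :: real and k :: "int ^ 'n"
  assume z: "norm z \<le> R" and \<sigma>: "0 < \<sigma>" "\<sigma> \<le> s"
  define y where "y = z + lattice_shift L k"
  have "\<bar>of_int (k $ l)\<bar> \<le> (norm y + R) * (1 / L $ l)" for l
  proof -
    have "of_int (k $ l) * L $ l = y $ l - z $ l" by (simp add: y_def lattice_shift_def)
    then have "\<bar>of_int (k $ l)\<bar> * L $ l = \<bar>y $ l - z $ l\<bar>"
      using L[of l] by (metis abs_mult abs_of_pos)
    also have "\<dots> \<le> norm y + R"
      using component_le_norm_cart[of y l] component_le_norm_cart[of z l] z by linarith
    finally show ?thesis using L[of l] by (simp add: field_simps)
  qed
  then have k: "(\<Sum>l\<in>UNIV. \<bar>of_int (k $ l)\<bar>) \<le> (norm y + R) * \<eta>"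
    unfolding \<eta>_def sum_distrib_left by (intro sum_mono)
  have "(norm y)\<^sup>2 / (2 * s\<^sup>2) \<le> (norm y)\<^sup>2 / (2 * \<sigma>\<^sup>2)"
    using \<sigma> by (intro divide_left_mono) (auto intro!: power_mono mult_pos_pos)
  moreover have "(\<rho> + \<eta>) * norm y \<le> (\<rho> + \<eta>)\<^sup>2 * s\<^sup>2 / 2 + (norm y)\<^sup>2 / (2 * s\<^sup>2)"
  proof -
    have "0 \<le> ((\<rho> + \<eta>) * s - norm y / s)\<^sup>2" by simp
    then show ?thesis using \<open>0 < s\<close>
      by (simp add: power2_diff power_mult_distrib power_divide field_simps flip: power2_eq_square)
         (simp add: field_simps power2_eq_square eval_nat_numeral)
  qed
  ultimately have "- (norm y)\<^sup>2 / (2 * \<sigma>\<^sup>2) + \<rho> * norm y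
      \<le> (\<rho> + \<eta>)\<^sup>2 * s\<^sup>2 / 2 + \<eta> * R - (\<Sum>l\<in>UNIV. \<bar>of_int (k $ l)\<bar>)"
    using k by (simp add: algebra_simps)
  then have "exp (- (norm y)\<^sup>2 / (2 * \<sigma>\<^sup>2) + \<rho> * norm y)
      \<le> exp ((\<rho> + \<eta>)\<^sup>2 * s\<^sup>2 / 2 + \<eta> * R + (\<Sum>l\<in>UNIV. - \<bar>of_int (k $ l)\<bar>))"
    by (simp add: sum_negf)
  then show "gauss \<sigma> (z + lattice_shift L k) * exp (\<rho> * norm (z + lattice_shift L k)) \<le> A * lattice_decay k"
    unfolding y_def[symmetric] gauss_def A_def lattice_decay_def
    by (simp only: exp_add exp_sum[OF finite_class.finite_UNIV])
qed

lemma gauss_pos: "0 < gauss \<sigma> y" by (simp add: gauss_def)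

lemma lattice_gauss_uniformly_continuous:
  fixes L :: "real ^ 'n"
  assumes L: "\<And>l. 0 < L $ l" and "0 < \<sigma>min" "\<sigma>min \<le> \<sigma>max"
  shows "uniformly_continuous_on (cball 0 R \<times> {\<sigma>min..\<sigma>max}) (\<lambda>(z, \<sigma>). lattice_sum K L (gauss \<sigma>) z)"
proof (rule compact_uniformly_continuous)
  let ?Y = "cball (0 :: real ^ 'n) R \<times> {\<sigma>min..\<sigma>max}"
  show "compact ?Y" by (intro compact_Times) auto
  have "0 < \<sigma>max" using assms by linarith
  obtain A where A: "\<And>z \<sigma> k. norm z \<le> R \<Longrightarrow> 0 < \<sigma> \<Longrightarrow> \<sigma> \<le> \<sigma>max \<Longrightarrow>
     gauss \<sigma> (z + lattice_shift L k) * exp (0 * norm (z + lattice_shift L k)) \<le> A * lattice_decay k"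
    using gauss_lattice_majorant[OF L \<open>0 < \<sigma>max\<close>, of R 0] by metis
  have "uniform_limit ?Y (\<lambda>X y. \<Sum>k\<in>X. gauss (snd y) (fst y + lattice_shift L k))
      (\<lambda>y. \<Sum>\<^sub>\<infinity>k\<in>K. gauss (snd y) (fst y + lattice_shift L k)) (finite_subsets_at_top K)"
  proof (rule Weierstrass_m_test_general)
    show "(\<lambda>k. A * lattice_decay k) summable_on K"
      by (rule summable_on_subset[OF summable_on_cmult_right[OF lattice_decay_summable]]) simp
    fix k and y :: "(real ^ 'n) \<times> real" assume "y \<in> ?Y"
    then show "norm (gauss (snd y) (fst y + lattice_shift L k)) \<le> A * lattice_decay k"
      using A[of "fst y" "snd y" k] assms by (auto simp: gauss_pos less_imp_le)
  qed
  then have "continuous_on ?Y (\<lambda>y. \<Sum>\<^sub>\<infinity>k\<in>K. gauss (snd y) (fst y + lattice_shift L k))"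
  proof (rule uniform_limit_theorem[rotated])
    show "\<forall>\<^sub>F X in finite_subsets_at_top K.
       continuous_on ?Y (\<lambda>y. \<Sum>k\<in>X. gauss (snd y) (fst y + lattice_shift L k))"
      unfolding gauss_def using \<open>0 < \<sigma>min\<close>
      by (intro always_eventually allI continuous_intros) auto
  qed simp
  then show "continuous_on ?Y (\<lambda>(z, \<sigma>). lattice_sum K L (gauss \<sigma>) z)"
    by (simp add: lattice_sum_def case_prod_unfold)
qed

lemma lattice_gauss_continuous:
  fixes L :: "real ^ 'n"
  assumes L: "\<And>l. 0 < L $ l" and "0 < snd \<theta>" and S: "bounded S"
  shows "continuous_on S (lattice_gauss K L \<theta>)"
proof -
  have "bounded ((\<lambda>x. x - fst \<theta>) ` S)"
    using bounded_translation[OF S, of "- fst \<theta>"] by simp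
  then obtain R where R: "\<And>x. x \<in> S \<Longrightarrow> norm (x - fst \<theta>) \<le> R"
    unfolding bounded_iff by auto
  have "continuous_on (cball 0 R \<times> {snd \<theta>..snd \<theta>}) (\<lambda>(z, \<sigma>). lattice_sum K L (gauss \<sigma>) z)"
    by (intro uniformly_continuous_imp_continuous lattice_gauss_uniformly_continuous L assms) simp
  then have "continuous_on S ((\<lambda>(z, \<sigma>). lattice_sum K L (gauss \<sigma>) z) \<circ> (\<lambda>x. (x - fst \<theta>, snd \<theta>)))"
    using R by (intro continuous_on_compose) (auto intro!: continuous_intros elim: continuous_on_subset)
  then show ?thesis by (simp add: o_def lattice_gauss_def[abs_def])
qed

lemma lattice_gauss_pos:
  fixes L :: "real ^ 'n"
  assumes L: "\<And>l. 0 < L $ l" and "0 < snd \<theta>" and "0 \<in> K"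
  shows "0 < lattice_gauss K L \<theta> x"
proof -
  obtain A where A: "\<And>z \<sigma> k. norm z \<le> norm (x - fst \<theta>) \<Longrightarrow> 0 < \<sigma> \<Longrightarrow> \<sigma> \<le> snd \<theta> \<Longrightarrow>
     gauss \<sigma> (z + lattice_shift L k) * exp (0 * norm (z + lattice_shift L k)) \<le> A * lattice_decay k"
    using gauss_lattice_majorant[OF L \<open>0 < snd \<theta>\<close>, of "norm (x - fst \<theta>)" 0] by metis
  have "(\<lambda>k. gauss (snd \<theta>) (x - fst \<theta> + lattice_shift L k)) summable_on K"
  proof (rule summable_on_comparison_test)
    show "(\<lambda>k. A * lattice_decay k) summable_on K"
      by (rule summable_on_subset[OF summable_on_cmult_right[OF lattice_decay_summable]]) simp
  next
    fix k
    show "gauss (snd \<theta>) (x - fst \<theta> + lattice_shift L k) \<le> A * lattice_decay k"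
      using A[of "x - fst \<theta>" "snd \<theta>" k] \<open>0 < snd \<theta>\<close> by simp
    show "0 \<le> gauss (snd \<theta>) (x - fst \<theta> + lattice_shift L k)"
      by (rule less_imp_le[OF gauss_pos])
  qed
  then have "infsum (\<lambda>k. gauss (snd \<theta>) (x - fst \<theta> + lattice_shift L k)) {0}
      \<le> lattice_gauss K L \<theta> x"
    unfolding lattice_gauss_def lattice_sum_def using \<open>0 \<in> K\<close>
    by (intro infsum_mono2) (auto simp: gauss_pos less_imp_le)
  then have "gauss (snd \<theta>) (x - fst \<theta> + lattice_shift L 0) \<le> lattice_gauss K L \<theta> x"
    by simp
  then show ?thesis by (rule less_le_trans[OF gauss_pos])
qed

text \<open>
  The features depend on \<open>x - c\<close> and \<open>\<sigma>\<close> through a uniformly continuous function, so that nearby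
  parameters give uniformly close features on \<open>S\<close>.
\<close>

lemma lattice_gauss_in_closure:
  fixes L :: "real ^ 'n"
  assumes L: "\<And>l. 0 < L $ l" and "0 < \<sigma>min" "\<sigma>min < \<sigma>max" and S: "bounded S"
    and U: "open U" "c \<in> U" and \<sigma>: "\<sigma> \<in> {\<sigma>min<..<\<sigma>max}"
    and dense: "\<And>b. open b \<Longrightarrow> b \<noteq> {} \<Longrightarrow> b \<subseteq> U \<times> {\<sigma>min<..<\<sigma>max} \<Longrightarrow>
        \<exists>\<theta>\<in>b. lattice_gauss K L \<theta> \<in> F"
  shows "lattice_gauss K L (c, \<sigma>) \<in> uniform_closure S F"
  unfolding uniform_closure_def
proof safe
  fix e :: real assume "e > 0"
  have "bounded ((\<lambda>x. x - c) ` S)"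
    using bounded_translation[OF S, of "- c"] by simp
  then obtain R where R: "\<And>x. x \<in> S \<Longrightarrow> norm (x - c) \<le> R"
    unfolding bounded_iff by auto
  have "uniformly_continuous_on (cball 0 (R + 1) \<times> {\<sigma>min..\<sigma>max}) (\<lambda>(z, \<sigma>). lattice_sum K L (gauss \<sigma>) z)"
    by (rule lattice_gauss_uniformly_continuous) (use assms in auto)
  then obtain d where d: "d > 0" "\<And>p q. p \<in> cball 0 (R + 1) \<times> {\<sigma>min..\<sigma>max} \<Longrightarrow>
      q \<in> cball 0 (R + 1) \<times> {\<sigma>min..\<sigma>max} \<Longrightarrow> dist q p < d \<Longrightarrow>
      dist ((\<lambda>(z, \<sigma>). lattice_sum K L (gauss \<sigma>) z) q) ((\<lambda>(z, \<sigma>). lattice_sum K L (gauss \<sigma>) z) p) < e"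
    unfolding uniformly_continuous_on_def using \<open>e > 0\<close> by meson
  define b where "b = ball (c, \<sigma>) (min d 1) \<inter> (U \<times> {\<sigma>min<..<\<sigma>max})"
  have "open b" unfolding b_def using U by (intro open_Int open_Times) auto
  moreover have "(c, \<sigma>) \<in> b" unfolding b_def using U \<sigma> d by auto
  ultimately obtain \<theta> where \<theta>: "\<theta> \<in> b" "lattice_gauss K L \<theta> \<in> F"
    using dense[of b] unfolding b_def by blast
  have near: "dist (c, \<sigma>) \<theta> < d" "dist (c, \<sigma>) \<theta> < 1" using \<theta>(1) by (auto simp: b_def)
  have "\<bar>lattice_gauss K L (c, \<sigma>) x - lattice_gauss K L \<theta> x\<bar> < e" if x: "x \<in> S" for x
  proof -
    have eq: "dist (x - c, \<sigma>) (x - fst \<theta>, snd \<theta>) = dist (c, \<sigma>) \<theta>"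
      by (cases \<theta>) (simp add: dist_prod_def dist_norm norm_minus_commute)
    have "dist c (fst \<theta>) \<le> dist (c, \<sigma>) \<theta>" using dist_fst_le[of "(c, \<sigma>)" \<theta>] by simp
    then have "norm (x - fst \<theta>) \<le> R + 1"
      using R[OF x] near norm_triangle_ineq[of "x - c" "c - fst \<theta>"] by (simp add: dist_norm)
    moreover have "snd \<theta> \<in> {\<sigma>min..\<sigma>max}" using \<theta>(1) by (auto simp: b_def)
    ultimately show ?thesis
      using d(2)[of "(x - fst \<theta>, snd \<theta>)" "(x - c, \<sigma>)"] near(1) eq R[OF x] \<sigma>
      by (simp add: lattice_gauss_def dist_real_def)
  qed
  with \<theta>(2) show "\<exists>g\<in>F. \<forall>x\<in>S. \<bar>lattice_gauss K L (c, \<sigma>) x - g x\<bar> < e"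
    by blast
qed


section \<open>Gaussians modulated by dual-lattice waves\<close>

text \<open>
  The frequencies whose waves do not change under the translations \<open>kL\<close>, \<open>k \<in> K\<close>. For \<open>K = {0}\<close> these
  are all vectors, and for \<open>K = UNIV\<close> the vectors with components in \<open>2\<pi>\<int> / L\<^sub>l\<close>.
\<close>

definition dual_lattice :: "(int ^ 'n) set \<Rightarrow> real ^ 'n \<Rightarrow> (real ^ 'n) set" where
  "dual_lattice K L = {v. \<forall>k\<in>K. \<exists>m::int. v \<bullet> lattice_shift L k = 2 * pi * of_int m}"

lemma cos_dual_lattice:
  assumes "v \<in> dual_lattice K L" "k \<in> K"
  shows "cos (v \<bullet> (z + lattice_shift L k) + p) = cos (v \<bullet> z + p)"
proof -
  obtain m :: int where "v \<bullet> lattice_shift L k = 2 * pi * of_int m"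
    using assms unfolding dual_lattice_def by auto
  then have "v \<bullet> (z + lattice_shift L k) + p = (v \<bullet> z + p) + 2 * pi * of_int m"
    by (simp add: inner_add_right)
  then show ?thesis by (simp only: cos_add[of _ "2 * pi * of_int m"] cos_int_2pin sin_int_2pin)
qed

text \<open>
  The weights are \<open>exp (- |y\<^sub>k|\<^sup>2 / 2\<sigma>\<^sup>2)\<close> and the variable is \<open>s\<^sub>k = v \<bullet> y\<^sub>k\<close> with \<open>y\<^sub>k = x - c + kL\<close>. Shifting
  the centre along \<open>v\<close> gives the exponentials \<open>exp (t s\<^sub>k)\<close>; continuing to imaginary \<open>t\<close> gives
  cosines of \<open>s\<^sub>k\<close>, which are independent of \<open>k\<close> when \<open>v\<close> is in the dual lattice.
\<close>

lemma gauss_modulated_in_closure: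
  fixes L :: "real ^ 'n"
  assumes L: "\<And>l. 0 < L $ l" and "0 < \<sigma>" and S: "bounded S" and F: "lincomb_closed F"
    and U: "open U" "c \<in> U"
    and feat: "\<And>c. c \<in> U \<Longrightarrow> lattice_gauss K L (c, \<sigma>) \<in> uniform_closure S F"
    and v: "v \<in> dual_lattice K L"
  shows "(\<lambda>x. lattice_gauss K L (c, \<sigma>) x * cos (v \<bullet> x + p)) \<in> uniform_closure S F"
proof -
  define T where "T q x = lattice_sum K L (\<lambda>y. gauss \<sigma> y * q (v \<bullet> y)) (x - c)" for q x
  have "bounded ((\<lambda>x. x - c) ` S)"
    using bounded_translation[OF S, of "- c"] by simp
  then obtain R where R: "\<And>x. x \<in> S \<Longrightarrow> norm (x - c) \<le> R"
    unfolding bounded_iff by auto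
  obtain A where A: "0 < A" "\<And>z \<tau> k. norm z \<le> R \<Longrightarrow> 0 < \<tau> \<Longrightarrow> \<tau> \<le> \<sigma> \<Longrightarrow>
     gauss \<tau> (z + lattice_shift L k) * exp ((3 * norm v) * norm (z + lattice_shift L k)) \<le> A * lattice_decay k"
    using gauss_lattice_majorant[OF L \<open>0 < \<sigma>\<close>, of R "3 * norm v"] by metis
  have term_le: "norm (gauss \<sigma> (x - c + lattice_shift L k) * q (v \<bullet> (x - c + lattice_shift L k)))
      \<le> C * A * lattice_decay k"
    if q: "\<And>s. \<bar>q s\<bar> \<le> C * exp (3 * \<bar>s\<bar>)" and x: "x \<in> S" for q :: "real \<Rightarrow> real" and C x k
  proof -
    define y where "y = x - c + lattice_shift L k"
    have "C \<ge> 0" using q[of 0] by auto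
    have "\<bar>q (v \<bullet> y)\<bar> \<le> C * exp (3 * \<bar>v \<bullet> y\<bar>)" by (rule q)
    also have "\<dots> \<le> C * exp ((3 * norm v) * norm y)"
      using \<open>C \<ge> 0\<close> Cauchy_Schwarz_ineq2[of v y] by (intro mult_left_mono) auto
    finally have "gauss \<sigma> y * \<bar>q (v \<bullet> y)\<bar> \<le> gauss \<sigma> y * (C * exp ((3 * norm v) * norm y))"
      by (intro mult_left_mono) (auto simp: gauss_pos less_imp_le)
    also have "\<dots> = C * (gauss \<sigma> y * exp ((3 * norm v) * norm y))" by simp
    also have "\<dots> \<le> C * (A * lattice_decay k)"
      unfolding y_def using \<open>C \<ge> 0\<close> \<open>0 < \<sigma>\<close> R[OF x] by (intro mult_left_mono A(2)) auto
    finally show ?thesis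
      unfolding y_def[symmetric] by (simp add: abs_mult gauss_pos less_imp_le mult.assoc)
  qed
  have maj: "(\<lambda>k. C * A * lattice_decay k) summable_on K" for C
    by (rule summable_on_subset[OF summable_on_cmult_right[OF lattice_decay_summable]]) simp
  have summ: "(\<lambda>k. gauss \<sigma> (x - c + lattice_shift L k) * q (v \<bullet> (x - c + lattice_shift L k))) summable_on K"
    if "exp_growth q" "x \<in> S" for q x
  proof -
    obtain C where "\<And>s. \<bar>q s\<bar> \<le> C * exp (3 * \<bar>s\<bar>)"
      using \<open>exp_growth q\<close> unfolding exp_growth_def by blast
    note C = this
    have "(\<lambda>k. norm (gauss \<sigma> (x - c + lattice_shift L k) * q (v \<bullet> (x - c + lattice_shift L k)))) summable_on K"
      using term_le[OF C \<open>x \<in> S\<close>]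
      by (intro Infinite_Sum.abs_summable_on_comparison_test'[OF maj])
    then show ?thesis by (rule Infinite_Sum.abs_summable_summable)
  qed
  interpret bounded_superposition T S "A * infsum lattice_decay K"
  proof
    fix q r a b x assume "exp_growth q" "exp_growth r" "x \<in> S"
    then have "infsum (\<lambda>k. a * (gauss \<sigma> (x - c + lattice_shift L k) * q (v \<bullet> (x - c + lattice_shift L k)))
          + b * (gauss \<sigma> (x - c + lattice_shift L k) * r (v \<bullet> (x - c + lattice_shift L k)))) K
        = a * T q x + b * T r x"
      unfolding T_def lattice_sum_def
      by (subst infsum_add) (auto intro!: summable_on_cmult_right summ simp: infsum_cmult_right')
    then show "T (\<lambda>s. a * q s + b * r s) x = a * T q x + b * T r x"
      unfolding T_def lattice_sum_def by (simp add: algebra_simps)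
  next
    fix q :: "real \<Rightarrow> real" and C x assume q: "\<And>s. \<bar>q s\<bar> \<le> C * exp (3 * \<bar>s\<bar>)" and x: "x \<in> S"
    have "norm (T q x) \<le> infsum (\<lambda>k. C * A * lattice_decay k) K"
      unfolding T_def lattice_sum_def
      by (rule norm_infsum_le[OF has_sum_infsum has_sum_infsum term_le[OF q x]])
         (use summ[OF exp_growthI[OF q] x] maj in auto)
    then show "\<bar>T q x\<bar> \<le> C * (A * infsum lattice_decay K)"
      by (simp add: infsum_cmult_right' mult.assoc)
  qed
  obtain r where r: "r > 0" "ball c r \<subseteq> U" using U open_contains_ball by metis
  define \<delta> where "\<delta> = min 1 (r / (\<sigma>\<^sup>2 * norm v + 1))"
  have pos: "\<sigma>\<^sup>2 * norm v + 1 > 0" by (intro add_nonneg_pos) auto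
  have "\<delta> \<le> r / (\<sigma>\<^sup>2 * norm v + 1)" unfolding \<delta>_def by simp
  then have \<delta>r: "\<delta> * (\<sigma>\<^sup>2 * norm v + 1) \<le> r" using pos by (simp only: pos_le_divide_eq)
  have \<delta>: "0 < \<delta>" "\<delta> \<le> 1" using r(1) pos by (simp_all add: \<delta>_def)
  have fam: "T (\<lambda>s. exp (t * s)) \<in> uniform_closure S F" if t: "\<bar>t\<bar> < \<delta>" for t
  proof -
    have "norm (t *\<^sub>R \<sigma>\<^sup>2 *\<^sub>R v) = \<bar>t\<bar> * (\<sigma>\<^sup>2 * norm v)" by (simp add: abs_mult)
    also have "\<dots> \<le> \<delta> * (\<sigma>\<^sup>2 * norm v)" using t by (intro mult_right_mono) auto
    also have "\<dots> < r" using \<delta>(1) \<delta>r by (simp add: algebra_simps)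
    finally have "c + t *\<^sub>R \<sigma>\<^sup>2 *\<^sub>R v \<in> U" using r(2) by (auto simp: dist_norm)
    then have f: "lattice_gauss K L (c + t *\<^sub>R \<sigma>\<^sup>2 *\<^sub>R v, \<sigma>) \<in> uniform_closure S F" by (rule feat)
    define E where "E = exp (t\<^sup>2 * \<sigma>\<^sup>2 * (norm v)\<^sup>2 / 2)"
    \<comment> \<open>Completing the square.\<close>
    have shifted: "gauss \<sigma> y * exp (t * (v \<bullet> y)) = E * gauss \<sigma> (y - t *\<^sub>R \<sigma>\<^sup>2 *\<^sub>R v)" for y
    proof -
      have "(norm (y - t *\<^sub>R \<sigma>\<^sup>2 *\<^sub>R v))\<^sup>2 = (norm y)\<^sup>2 - 2 * t * \<sigma>\<^sup>2 * (v \<bullet> y) + t\<^sup>2 * \<sigma>\<^sup>2 * \<sigma>\<^sup>2 * (norm v)\<^sup>2"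
        unfolding power2_norm_eq_inner
        by (simp add: inner_diff_left inner_diff_right inner_commute[of y v] power2_eq_square algebra_simps)
      then have "- (norm y)\<^sup>2 / (2 * \<sigma>\<^sup>2) + t * (v \<bullet> y) =
          t\<^sup>2 * \<sigma>\<^sup>2 * (norm v)\<^sup>2 / 2 + - (norm (y - t *\<^sub>R \<sigma>\<^sup>2 *\<^sub>R v))\<^sup>2 / (2 * \<sigma>\<^sup>2)"
        using \<open>0 < \<sigma>\<close> by (simp add: field_simps power2_eq_square)
      then show ?thesis unfolding gauss_def E_def by (metis exp_add)
    qed
    have "E * lattice_gauss K L (c + t *\<^sub>R \<sigma>\<^sup>2 *\<^sub>R v, \<sigma>) x + 0 * lattice_gauss K L (c + t *\<^sub>R \<sigma>\<^sup>2 *\<^sub>R v, \<sigma>) x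
        = T (\<lambda>s. exp (t * s)) x" for x
      unfolding T_def lattice_sum_def lattice_gauss_def shifted
      by (simp add: infsum_cmult_right' algebra_simps)
    with uniform_closure_lincomb[OF F f f, of E 0] show ?thesis
      by (auto elim: uniform_closure_cong)
  qed
  have "T (\<lambda>s. cos (s + (v \<bullet> c + p))) \<in> uniform_closure S F"
    by (rule cos_in_closure[OF F \<delta> fam])
  moreover have "T (\<lambda>s. cos (s + (v \<bullet> c + p))) x = lattice_gauss K L (c, \<sigma>) x * cos (v \<bullet> x + p)" for x
  proof -
    have "T (\<lambda>s. cos (s + (v \<bullet> c + p))) x
        = (\<Sum>\<^sub>\<infinity>k\<in>K. gauss \<sigma> (x - c + lattice_shift L k) * cos (v \<bullet> x + p))"
      unfolding T_def lattice_sum_def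
      by (intro infsum_cong) (simp add: cos_dual_lattice[OF v] inner_diff_right)
    then show ?thesis by (simp add: infsum_cmult_left' lattice_gauss_def lattice_sum_def)
  qed
  ultimately show ?thesis by (auto elim: uniform_closure_cong)
qed

section \<open>Density of trigonometric polynomials\<close>

text \<open>
  Free phases \<open>p\<close> make sines superfluous and reduce closure under products to one product-to-sum formula.
\<close>

inductive_set trig_poly :: "(real ^ 'n) set \<Rightarrow> (real ^ 'n \<Rightarrow> real) set" for G where
  wave: "v \<in> G \<Longrightarrow> (\<lambda>x. a * cos (v \<bullet> x + p)) \<in> trig_poly G"
| add: "f \<in> trig_poly G \<Longrightarrow> g \<in> trig_poly G \<Longrightarrow> (\<lambda>x. f x + g x) \<in> trig_poly G"

lemma trig_poly_mult:
  assumes G: "\<And>v w. v \<in> G \<Longrightarrow> w \<in> G \<Longrightarrow> v + w \<in> G \<and> v - w \<in> G"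
    and "f \<in> trig_poly G" "g \<in> trig_poly G"
  shows "(\<lambda>x. f x * g x) \<in> trig_poly G"
  using assms(2)
proof induction
  case (wave v a p)
  from assms(3) show ?case
  proof induction
    case (wave w b q)
    have "(\<lambda>x. a * b / 2 * cos ((v - w) \<bullet> x + (p - q)) + a * b / 2 * cos ((v + w) \<bullet> x + (p + q))) \<in> trig_poly G"
      using G \<open>v \<in> G\<close> wave by (intro trig_poly.intros) auto
    moreover have "a * b / 2 * cos ((v - w) \<bullet> x + (p - q)) + a * b / 2 * cos ((v + w) \<bullet> x + (p + q))
        = a * cos (v \<bullet> x + p) * (b * cos (w \<bullet> x + q))" for x
    proof -
      have "cos (v \<bullet> x + p) * cos (w \<bullet> x + q)
          = (cos ((v \<bullet> x + p) - (w \<bullet> x + q)) + cos ((v \<bullet> x + p) + (w \<bullet> x + q))) / 2"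
        by (rule cos_times_cos)
      also have "(v \<bullet> x + p) - (w \<bullet> x + q) = (v - w) \<bullet> x + (p - q)" by (simp add: inner_diff_left)
      also have "(v \<bullet> x + p) + (w \<bullet> x + q) = (v + w) \<bullet> x + (p + q)" by (simp add: inner_add_left)
      finally have "a * b * (cos (v \<bullet> x + p) * cos (w \<bullet> x + q))
          = a * b * ((cos ((v - w) \<bullet> x + (p - q)) + cos ((v + w) \<bullet> x + (p + q))) / 2)"
        by (rule arg_cong)
      then show ?thesis by (simp only: distrib_left add_divide_distrib mult_ac times_divide_eq_left times_divide_eq_right)
    qed
    ultimately show ?case by simp
  next
    case (add f g)
    from trig_poly.add[OF add.IH] show ?case by (simp add: distrib_left)
  qed
next
  case (add f g)
  from trig_poly.add[OF add.IH] show ?case by (simp add: distrib_right)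
qed

lemma trig_poly_continuous: "f \<in> trig_poly G \<Longrightarrow> continuous_on S f"
  by (induction rule: trig_poly.induct) (auto intro!: continuous_intros)

lemma dual_lattice_add_diff:
  assumes "v \<in> dual_lattice K L" "w \<in> dual_lattice K L"
  shows "v + w \<in> dual_lattice K L \<and> v - w \<in> dual_lattice K L"
proof -
  have "(\<exists>i::int. (v + w) \<bullet> lattice_shift L k = 2 * pi * of_int i) \<and>
      (\<exists>i::int. (v - w) \<bullet> lattice_shift L k = 2 * pi * of_int i)" if k: "k \<in> K" for k
  proof -
    obtain i j :: int where
      "v \<bullet> lattice_shift L k = 2 * pi * of_int i" "w \<bullet> lattice_shift L k = 2 * pi * of_int j"
      using assms k unfolding dual_lattice_def by blast
    then have "(v + w) \<bullet> lattice_shift L k = 2 * pi * of_int (i + j)"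
      "(v - w) \<bullet> lattice_shift L k = 2 * pi * of_int (i - j)"
      by (simp_all add: inner_add_left inner_diff_left algebra_simps)
    then show ?thesis by blast
  qed
  then show ?thesis unfolding dual_lattice_def by blast
qed

lemma zero_in_dual_lattice: "0 \<in> dual_lattice K L"
  by (auto simp: dual_lattice_def)

lemma trig_poly_periodic:
  assumes "f \<in> trig_poly (dual_lattice K L)" "k \<in> K"
  shows "f (x + lattice_shift L k) = f x"
  using assms(1) by induction (auto simp: cos_dual_lattice[OF _ \<open>k \<in> K\<close>])

text \<open>
  A continuous image of a compact space in a Hausdorff space carries the quotient topology.
\<close>

lemma continuous_factor_through_compact:
  fixes E :: "'a::t2_space \<Rightarrow> 'b::t2_space" and u :: "'a \<Rightarrow> 'c::topological_space"
  assumes S: "compact S" and E: "continuous_on S E" and u: "continuous_on S u"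
    and resp: "\<And>x y. x \<in> S \<Longrightarrow> y \<in> S \<Longrightarrow> E x = E y \<Longrightarrow> u x = u y"
  obtains h where "continuous_on (E ` S) h" "\<And>x. x \<in> S \<Longrightarrow> h (E x) = u x"
proof
  define h where "h z = u (SOME x. x \<in> S \<and> E x = z)" for z
  show h: "h (E x) = u x" if "x \<in> S" for x
  proof -
    let ?y = "SOME y. y \<in> S \<and> E y = E x"
    have "?y \<in> S \<and> E ?y = E x" by (rule someI[of _ x]) (use that in simp)
    then show ?thesis unfolding h_def using resp that by blast
  qed
  show "continuous_on (E ` S) h"
    unfolding continuous_on_closed_invariant
  proof (intro allI impI)
    fix B :: "'c set" assume "closed B"
    have "closed S" using S by (rule compact_imp_closed)
    then have "closed (u -` B \<inter> S)"
      using u \<open>closed B\<close> continuous_on_closed_vimage by blast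
    then have "compact (S \<inter> (u -` B \<inter> S))" by (rule compact_Int_closed[OF S])
    then have "compact (E ` (S \<inter> (u -` B \<inter> S)))"
      by (intro compact_continuous_image continuous_on_subset[OF E]) auto
    then have "closed (E ` (S \<inter> (u -` B \<inter> S)))" by (rule compact_imp_closed)
    moreover have "E ` (S \<inter> (u -` B \<inter> S)) \<inter> E ` S = h -` B \<inter> E ` S"
      using h by auto
    ultimately show "\<exists>A. closed A \<and> A \<inter> E ` S = h -` B \<inter> E ` S" by blast
  qed
qed

text \<open>
  Periodic functions do not separate opposite faces of a cell. They do separate the points of the image
  of the cell under a map \<open>E\<close> onto the torus, and the classical theorem is applied to that image.
\<close>

lemma Stone_Weierstrass_factored:
  fixes E :: "'a::t2_space \<Rightarrow> 'b::t2_space"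
  assumes S: "compact S" and E: "continuous_on S E"
    and cont: "\<And>f. f \<in> A \<Longrightarrow> continuous_on S f"
    and add: "\<And>f g. f \<in> A \<Longrightarrow> g \<in> A \<Longrightarrow> (\<lambda>x. f x + g x) \<in> A"
    and mult: "\<And>f g. f \<in> A \<Longrightarrow> g \<in> A \<Longrightarrow> (\<lambda>x. f x * g x) \<in> A"
    and const: "\<And>c. (\<lambda>_. c) \<in> A"
    and resp: "\<And>f x y. f \<in> A \<Longrightarrow> x \<in> S \<Longrightarrow> y \<in> S \<Longrightarrow> E x = E y \<Longrightarrow> f x = f y"
    and sep: "\<And>x y. x \<in> S \<Longrightarrow> y \<in> S \<Longrightarrow> E x \<noteq> E y \<Longrightarrow> \<exists>f\<in>A. f x \<noteq> f y"
    and u: "continuous_on S u"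
    and u_resp: "\<And>x y. x \<in> S \<Longrightarrow> y \<in> S \<Longrightarrow> E x = E y \<Longrightarrow> u x = u y"
  shows "u \<in> uniform_closure S A"
proof -
  define R where "R = {h. continuous_on (E ` S) h \<and> (\<exists>a\<in>A. \<forall>x\<in>S. h (E x) = a x)}"
  interpret function_ring_on R "E ` S"
  proof
    show "compact (E ` S)" using E S by (rule compact_continuous_image)
    show "continuous_on (E ` S) f" if "f \<in> R" for f using that by (simp add: R_def)
    show "(\<lambda>z. f z + g z) \<in> R" if fg: "f \<in> R" "g \<in> R" for f g
    proof -
      obtain a b where "a \<in> A" "\<forall>x\<in>S. f (E x) = a x" "b \<in> A" "\<forall>x\<in>S. g (E x) = b x"
        using fg by (auto simp: R_def)
      then have "\<exists>a\<in>A. \<forall>x\<in>S. f (E x) + g (E x) = a x"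
        by (intro bexI[OF _ add[of a b]]) auto
      then show ?thesis using fg by (auto simp: R_def intro: continuous_on_add)
    qed
    show "(\<lambda>z. f z * g z) \<in> R" if fg: "f \<in> R" "g \<in> R" for f g
    proof -
      obtain a b where "a \<in> A" "\<forall>x\<in>S. f (E x) = a x" "b \<in> A" "\<forall>x\<in>S. g (E x) = b x"
        using fg by (auto simp: R_def)
      then have "\<exists>a\<in>A. \<forall>x\<in>S. f (E x) * g (E x) = a x"
        by (intro bexI[OF _ mult[of a b]]) auto
      then show ?thesis using fg by (auto simp: R_def intro: continuous_on_mult)
    qed
    show "(\<lambda>_. c) \<in> R" for c
      unfolding R_def using const[of c] by (auto intro!: bexI[of _ "\<lambda>_. c"])
    show "\<exists>f\<in>R. f z \<noteq> f z'" if z: "z \<in> E ` S" "z' \<in> E ` S" "z \<noteq> z'" for z z'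
    proof -
      obtain x y where xy: "x \<in> S" "y \<in> S" "z = E x" "z' = E y" using z by auto
      then obtain a where a: "a \<in> A" "a x \<noteq> a y" using sep z(3) by blast
      obtain h where h: "continuous_on (E ` S) h" "\<And>x. x \<in> S \<Longrightarrow> h (E x) = a x"
        using continuous_factor_through_compact[OF S E cont[OF a(1)] resp[OF a(1)]] by blast
      have "h \<in> R" unfolding R_def using h a(1) by blast
      moreover have "h z \<noteq> h z'" using h(2) xy a(2) by simp
      ultimately show ?thesis by blast
    qed
  qed
  obtain h where h: "continuous_on (E ` S) h" "\<And>x. x \<in> S \<Longrightarrow> h (E x) = u x"
    using continuous_factor_through_compact[OF S E u u_resp] by blast
  show ?thesis
    unfolding uniform_closure_def
  proof safe
    fix e :: real assume "e > 0"
    then obtain g where g: "g \<in> R" "\<forall>z\<in>E ` S. \<bar>h z - g z\<bar> < e"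
      using Stone_Weierstrass_basic[OF h(1)] by blast
    then obtain a where a: "a \<in> A" "\<forall>x\<in>S. g (E x) = a x" by (auto simp: R_def)
    have "\<forall>x\<in>S. \<bar>u x - a x\<bar> < e"
      using g(2) a(2) h(2) by (metis imageI)
    with a(1) show "\<exists>g\<in>A. \<forall>x\<in>S. \<bar>u x - g x\<bar> < e" by blast
  qed
qed

lemmas trig_poly_dual_lattice_mult = trig_poly_mult[OF dual_lattice_add_diff]

lemma trig_poly_const: "(\<lambda>_. c) \<in> trig_poly (dual_lattice K L)"
  using trig_poly.wave[OF zero_in_dual_lattice, of c 0 K L] by simp

lemma trig_poly_dense:
  fixes L :: "real ^ 'n"
  assumes S: "compact S" and u: "continuous_on S u"
  shows "u \<in> uniform_closure S (trig_poly (dual_lattice {0} L))"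
proof (rule Stone_Weierstrass_factored[OF S, where E = "\<lambda>x. x"])
  show "\<exists>f\<in>trig_poly (dual_lattice {0} L). f x \<noteq> f y" if "x \<noteq> y" for x y
  proof -
    define v where "v = (pi / (norm (x - y))\<^sup>2) *\<^sub>R (x - y)"
    have "v \<bullet> (x - y) = pi"
      using \<open>x \<noteq> y\<close> by (simp add: v_def power2_norm_eq_inner)
    then have "cos (v \<bullet> x + (- (v \<bullet> y))) = - 1" by (simp add: inner_diff_right)
    moreover have "v \<in> dual_lattice {0} L"
      by (auto simp: dual_lattice_def lattice_shift_def zero_vec_def[symmetric] intro!: exI[of _ 0])
    ultimately show ?thesis
      by (intro bexI[OF _ trig_poly.wave[of v _ 1 "- (v \<bullet> y)"]]) auto
  qed
qed (auto intro: trig_poly_continuous trig_poly.add trig_poly_dual_lattice_mult trig_poly_const u)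

text \<open>
  The torus is realised as the image of \<open>x \<mapsto> (exp (2\<pi>i x\<^sub>l / L\<^sub>l))\<^sub>l\<close>, whose fibres are the cosets of the
  period lattice and whose components are themselves dual-lattice waves.
\<close>

lemma periodic_trig_poly_dense:
  fixes L :: "real ^ 'n"
  assumes L: "\<And>l. 0 < L $ l" and S: "compact S" and u: "continuous_on S u"
    and per: "\<And>x k. x \<in> S \<Longrightarrow> x + lattice_shift L k \<in> S \<Longrightarrow> u (x + lattice_shift L k) = u x"
  shows "u \<in> uniform_closure S (trig_poly (dual_lattice UNIV L))"
proof -
  define E :: "real ^ 'n \<Rightarrow> complex ^ 'n" where "E x = (\<chi> l. cis (2 * pi * x $ l / L $ l))" for x
  have E_eq: "\<exists>k. y = x + lattice_shift L k" if "E x = E y" for x y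
  proof -
    have "\<exists>n::int. y $ l = x $ l + of_int n * L $ l" for l
    proof -
      have "cis (2 * pi * y $ l / L $ l) = cis (2 * pi * x $ l / L $ l)"
        using that by (simp add: E_def vec_eq_iff)
      then have "sin (2 * pi * y $ l / L $ l) = sin (2 * pi * x $ l / L $ l) \<and>
          cos (2 * pi * y $ l / L $ l) = cos (2 * pi * x $ l / L $ l)"
        by (simp add: complex_eq_iff)
      then obtain n :: int where "2 * pi * y $ l / L $ l = 2 * pi * x $ l / L $ l + 2 * pi * of_int n"
        unfolding sin_cos_eq_iff by blast
      then have "2 * pi * (y $ l) = 2 * pi * (x $ l + of_int n * L $ l)"
        using L[of l] by (simp add: field_simps)
      then have "y $ l = x $ l + of_int n * L $ l" by (simp only: mult_cancel_left) simp
      then show ?thesis by blast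
    qed
    then obtain n :: "'n \<Rightarrow> int" where "\<And>l. y $ l = x $ l + of_int (n l) * L $ l" by metis
    then have "y = x + lattice_shift L (\<chi> l. n l)" by (simp add: vec_eq_iff lattice_shift_def)
    then show ?thesis by blast
  qed
  show ?thesis
  proof (rule Stone_Weierstrass_factored[OF S, where E = E])
    show "continuous_on S E"
      unfolding E_def using L by (intro continuous_intros) (metis less_irrefl)+
    show "f x = f y" if "f \<in> trig_poly (dual_lattice UNIV L)" "E x = E y" for f x y
      using E_eq[OF that(2)] trig_poly_periodic[OF that(1)] by auto
    show "u x = u y" if "x \<in> S" "y \<in> S" "E x = E y" for x y
      using E_eq[OF that(3)] per that by metis
    show "\<exists>f\<in>trig_poly (dual_lattice UNIV L). f x \<noteq> f y" if xy: "E x \<noteq> E y" for x y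
    proof -
      obtain l where l: "cis (2 * pi * x $ l / L $ l) \<noteq> cis (2 * pi * y $ l / L $ l)"
        using xy by (auto simp: E_def vec_eq_iff)
      define v :: "real ^ 'n" where "v = axis l (2 * pi / L $ l)"
      have v: "v \<bullet> z = 2 * pi * z $ l / L $ l" for z
        by (simp add: v_def inner_axis')
      have vd: "v \<in> dual_lattice UNIV L"
        unfolding dual_lattice_def using L[of l]
        by (auto simp: v lattice_shift_def intro!: exI)
      have "cos (v \<bullet> x + 0) \<noteq> cos (v \<bullet> y + 0) \<or> cos (v \<bullet> x + - (pi / 2)) \<noteq> cos (v \<bullet> y + - (pi / 2))"
      proof (rule ccontr)
        assume "\<not> ?thesis"
        then have "cos (v \<bullet> x) = cos (v \<bullet> y)" "sin (v \<bullet> x) = sin (v \<bullet> y)"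
          by (simp_all add: cos_diff)
        then show False using l by (simp add: v complex_eq_iff)
      qed
      then obtain p where "cos (v \<bullet> x + p) \<noteq> cos (v \<bullet> y + p)" by blast
      then show ?thesis by (intro bexI[OF _ trig_poly.wave[OF vd, of 1 p]]) auto
    qed
  qed (auto intro: trig_poly_continuous trig_poly.add trig_poly_dual_lattice_mult trig_poly_const u)
qed


section \<open>Uniform density of the span of Gaussian features\<close>

lemma times_trig_poly_in_closure:
  assumes F: "lincomb_closed F"
    and wave: "\<And>v p. v \<in> G \<Longrightarrow> (\<lambda>x. \<Phi> x * cos (v \<bullet> x + p)) \<in> uniform_closure S F"
    and "u \<in> trig_poly G"
  shows "(\<lambda>x. \<Phi> x * u x) \<in> uniform_closure S F"
  using assms(3)
proof induction
  case (wave v a p)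
  from uniform_closure_lincomb[OF F assms(2)[OF wave] assms(2)[OF wave], of a p 0 p]
  show ?case by (auto elim: uniform_closure_cong)
next
  case (add f g)
  from uniform_closure_lincomb[OF F add.IH, of 1 1]
  show ?case by (auto elim: uniform_closure_cong simp: distrib_left)
qed

text \<open>
  The last hypothesis is the only place where the two cases differ: it says that the quotient of \<open>f\<close> by
  a feature is a uniform limit of trigonometric polynomials with frequencies in the dual lattice. It
  encodes the continuity of \<open>f\<close> and its periods in \<open>K\<close>.
\<close>

theorem lattice_gauss_span_dense:
  fixes L :: "real ^ 'n"
  assumes L: "\<And>l. 0 < L $ l" and \<sigma>: "0 < \<sigma>min" "\<sigma>min < \<sigma>max" and "0 \<in> K"
    and S: "compact S" and U: "open U" "U \<noteq> {}" and F: "lincomb_closed F"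
    and hit: "\<And>b. open b \<Longrightarrow> b \<noteq> {} \<Longrightarrow> b \<subseteq> U \<times> {\<sigma>min<..<\<sigma>max} \<Longrightarrow>
        \<exists>\<theta>\<in>b. lattice_gauss K L \<theta> \<in> F"
    and trig: "\<And>\<theta>. 0 < snd \<theta> \<Longrightarrow>
        (\<lambda>x. f x / lattice_gauss K L \<theta> x) \<in> uniform_closure S (trig_poly (dual_lattice K L))"
  shows "f \<in> uniform_closure S F"
proof -
  define \<sigma> where "\<sigma> = (\<sigma>min + \<sigma>max) / 2"
  have \<sigma>_in: "\<sigma> \<in> {\<sigma>min<..<\<sigma>max}" "0 < \<sigma>" using \<sigma> by (auto simp: \<sigma>_def)
  obtain c where "c \<in> U" using U by blast
  have bS: "bounded S" using S by (rule compact_imp_bounded)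
  let ?\<Phi> = "lattice_gauss K L (c, \<sigma>)"
  have mem: "lattice_gauss K L (c, \<sigma>) \<in> uniform_closure S F" if "c \<in> U" for c
    by (rule lattice_gauss_in_closure[OF L \<sigma> bS U(1) that \<sigma>_in(1) hit])
  have wave: "(\<lambda>x. ?\<Phi> x * cos (v \<bullet> x + p)) \<in> uniform_closure S F"
    if "v \<in> dual_lattice K L" for v p
    by (rule gauss_modulated_in_closure[OF L \<sigma>_in(2) bS F U(1) \<open>c \<in> U\<close> mem that])
  have "continuous_on S ?\<Phi>" using \<sigma>_in bS by (intro lattice_gauss_continuous L) auto
  then have "bounded (?\<Phi> ` S)" using S by (intro compact_imp_bounded compact_continuous_image)
  then obtain B where B: "\<And>x. x \<in> S \<Longrightarrow> \<bar>?\<Phi> x\<bar> \<le> B" unfolding bounded_iff by auto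
  have "(\<lambda>x. ?\<Phi> x * (f x / ?\<Phi> x)) \<in> uniform_closure S F"
    by (rule uniform_closure_mult_bounded[OF B times_trig_poly_in_closure[OF F wave] trig])
       (use \<sigma>_in in auto)
  then show ?thesis
  proof (rule uniform_closure_cong)
    fix x
    have "?\<Phi> x > 0" using \<sigma>_in by (intro lattice_gauss_pos L \<open>0 \<in> K\<close>) auto
    then show "?\<Phi> x * (f x / ?\<Phi> x) = f x" by simp
  qed
qed

lemma lincomb_closed_span: "lincomb_closed (module.span fun_scale B)"
proof -
  interpret V: vector_space "fun_scale :: real \<Rightarrow> ('a \<Rightarrow> real) \<Rightarrow> _" by (rule vector_space_fun_scale)
  have "(\<lambda>x. a * f x + b * g x) \<in> V.span B" if "f \<in> V.span B" "g \<in> V.span B" for f g a b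
    using V.span_add[OF V.span_scale[OF that(1), of a] V.span_scale[OF that(2), of b]]
    by (simp add: plus_fun_def)
  then show ?thesis using V.span_zero unfolding lincomb_closed_def by blast
qed

lemma span_subset_lincomb_closed:
  assumes H: "lincomb_closed H" and "B \<subseteq> H"
  shows "module.span fun_scale B \<subseteq> H"
proof -
  interpret V: vector_space "fun_scale :: real \<Rightarrow> ('a \<Rightarrow> real) \<Rightarrow> _" by (rule vector_space_fun_scale)
  have lin: "(\<lambda>x. a * f x + b * g x) \<in> H" if "f \<in> H" "g \<in> H" for f g a b
    using H that unfolding lincomb_closed_def by blast
  obtain h where "h \<in> H" using H unfolding lincomb_closed_def by blast
  have "V.subspace H"
    unfolding V.subspace_def
  proof safe
    show "0 \<in> H" using lin[OF \<open>h \<in> H\<close> \<open>h \<in> H\<close>, of 0 0] by (simp add: zero_fun_def)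
    show "f + g \<in> H" if "f \<in> H" "g \<in> H" for f g
      using lin[OF that, of 1 1] by (simp add: plus_fun_def)
    show "(\<lambda>x. c * f x) \<in> H" if "f \<in> H" for f c
      using lin[OF that that, of c 0] by simp
  qed
  then show ?thesis using \<open>B \<subseteq> H\<close> by (rule V.span_minimal[rotated])
qed

definition RF_union :: "(nat \<Rightarrow> 'a \<Rightarrow> real) \<Rightarrow> ('a \<Rightarrow> real) set" where
  "RF_union \<phi> = (\<Union>M\<in>{1..}. V_RF \<phi> M)"

lemma lincomb_closed_RF_union: "lincomb_closed (RF_union \<phi>)"
  unfolding lincomb_closed_def
proof (intro conjI ballI allI)
  interpret V: vector_space "fun_scale :: real \<Rightarrow> ('a \<Rightarrow> real) \<Rightarrow> _" by (rule vector_space_fun_scale)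
  show "RF_union \<phi> \<noteq> {}" unfolding RF_union_def V_RF_def using V.span_zero by blast
  fix f g a b assume "f \<in> RF_union \<phi>" "g \<in> RF_union \<phi>"
  then obtain M N where MN: "M \<ge> 1" "f \<in> V_RF \<phi> M" "N \<ge> 1" "g \<in> V_RF \<phi> N"
    unfolding RF_union_def by auto
  have "V_RF \<phi> M \<subseteq> V_RF \<phi> (max M N)" "V_RF \<phi> N \<subseteq> V_RF \<phi> (max M N)"
    unfolding V_RF_def by (auto intro!: V.span_mono)
  with MN have "(\<lambda>x. a * f x + b * g x) \<in> V_RF \<phi> (max M N)"
    using lincomb_closed_span[of "\<phi> ` {1..max M N}"] unfolding lincomb_closed_def V_RF_def by blast
  then show "(\<lambda>x. a * f x + b * g x) \<in> RF_union \<phi>"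
    unfolding RF_union_def using MN(1) by (intro UN_I[of "max M N"]) auto
qed

lemma feature_in_RF_union: "j \<ge> 1 \<Longrightarrow> \<phi> j \<in> RF_union \<phi>"
proof -
  interpret V: vector_space "fun_scale :: real \<Rightarrow> ('a \<Rightarrow> real) \<Rightarrow> _" by (rule vector_space_fun_scale)
  show "\<phi> j \<in> RF_union \<phi>" if "j \<ge> 1"
    unfolding RF_union_def V_RF_def using that by (intro UN_I[of j] V.span_base) auto
qed

lemma RF_union_subset:
  assumes "lincomb_closed H" "\<And>j. j \<ge> 1 \<Longrightarrow> \<phi> j \<in> H"
  shows "RF_union \<phi> \<subseteq> H"
  unfolding RF_union_def V_RF_def
  by (intro UN_least span_subset_lincomb_closed) (use assms in auto)


lemma mspace_C_space:
  "compact S \<Longrightarrow> mspace (C_space S) = {f. f \<in> extensional S \<and> continuous_on S f}"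
  unfolding C_space_def
  by (subst compactin_mspace_cfunspace) (auto simp: mtopology_of_euclidean)

text \<open>
  The set \<open>Q\<close> is the closed condition that cuts out the function space: everything for the plain
  features, equality on opposite faces for the periodic ones.
\<close>

lemma sup_closure_eq_mspace:
  assumes S: "compact S"
    and F: "\<And>f. f \<in> F \<Longrightarrow> continuous_on S f \<and> restrict f S \<in> Q"
    and dense: "\<And>f. f \<in> Q \<Longrightarrow> continuous_on S f \<Longrightarrow> f \<in> uniform_closure S F"
  shows "sup_closure S (submetric (C_space S) Q) F = mspace (submetric (C_space S) Q)"
proof -
  let ?C = "submetric (C_space S) Q"
  interpret C: Metric_space "mspace ?C" "mdist ?C" by (rule Metric_space_mspace_mdist)
  have FC: "restrict f S \<in> mspace ?C" if "f \<in> F" for f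
    using F[OF that] S by (auto simp: mspace_C_space cong: continuous_on_cong)
  have "f \<in> C.mtopology closure_of ((\<lambda>f. restrict f S) ` F)" if f: "f \<in> mspace ?C" for f
    unfolding C.metric_closure_of
  proof (intro CollectI conjI allI impI)
    fix r :: real assume "r > 0"
    have "f \<in> uniform_closure S F" using f S by (intro dense) (auto simp: mspace_C_space)
    then obtain g where g: "g \<in> F" "\<And>x. x \<in> S \<Longrightarrow> \<bar>f x - g x\<bar> < r / 2"
      using uniform_closureD[of f S F "r / 2"] \<open>r > 0\<close> by auto
    have "mdist ?C f (restrict g S) \<le> r / 2"
      unfolding mdist_submetric C_space_def
      using g(2) \<open>r > 0\<close> by (intro mdist_cfunspace_le) (auto simp: dist_real_def less_imp_le)
    then have "restrict g S \<in> C.mball f r"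
      using f FC[OF g(1)] \<open>r > 0\<close> unfolding C.in_mball by linarith
    then show "\<exists>y\<in>(\<lambda>f. restrict f S) ` F. y \<in> C.mball f r" using g(1) by blast
  qed (rule f)
  moreover have "C.mtopology closure_of ((\<lambda>f. restrict f S) ` F) \<subseteq> mspace ?C"
    unfolding C.metric_closure_of by blast
  ultimately show ?thesis unfolding sup_closure_def mtopology_of_def by blast
qed

section \<open>From uniform density to density in the square mean\<close>

definition clamp_real :: "real \<Rightarrow> real \<Rightarrow> real" where
  "clamp_real N t = max (- N) (min N t)"

lemma clamp_real_le: "0 \<le> N \<Longrightarrow> \<bar>clamp_real N t\<bar> \<le> N"
  by (auto simp: clamp_real_def)

lemma continuous_on_clamp_real:
  "continuous_on A g \<Longrightarrow> continuous_on A (\<lambda>x. clamp_real N (g x))"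
  unfolding clamp_real_def by (intro continuous_intros)

lemma L2_truncation:
  assumes f: "f \<in> L2_space M" and "e > 0"
  obtains N :: nat where "(\<integral>x. (f x - clamp_real N (f x))\<^sup>2 \<partial>M) < e"
    "integrable M (\<lambda>x. (f x - clamp_real N (f x))\<^sup>2)"
proof -
  have [measurable]: "f \<in> borel_measurable M" and int: "integrable M (\<lambda>x. (f x)\<^sup>2)"
    using f by (auto simp: L2_space_def)
  have lim: "(\<lambda>N. (f x - clamp_real (real N) (f x))\<^sup>2) \<longlonglongrightarrow> 0" for x
  proof (rule tendsto_eventually)
    obtain N0 :: nat where "\<bar>f x\<bar> \<le> real N0" using real_arch_simple by blast
    then show "\<forall>\<^sub>F N in sequentially. (f x - clamp_real (real N) (f x))\<^sup>2 = 0"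
      by (intro eventually_sequentiallyI[of N0]) (auto simp: clamp_real_def)
  qed
  have le: "norm ((f x - clamp_real (real N) (f x))\<^sup>2) \<le> (f x)\<^sup>2" for x N
  proof -
    have "\<bar>f x - clamp_real (real N) (f x)\<bar> \<le> \<bar>f x\<bar>" by (auto simp: clamp_real_def)
    then show ?thesis by (simp add: abs_le_square_iff)
  qed
  have meas: "(\<lambda>x. (f x - clamp_real (real N) (f x))\<^sup>2) \<in> borel_measurable M" for N
    unfolding clamp_real_def by measurable
  have "(\<lambda>N. \<integral>x. (f x - clamp_real (real N) (f x))\<^sup>2 \<partial>M) \<longlonglongrightarrow> (\<integral>x. 0 \<partial>M)"
    by (rule integral_dominated_convergence[OF _ meas int]) (use lim le in auto)
  then have "\<forall>\<^sub>F N in sequentially. (\<integral>x. (f x - clamp_real (real N) (f x))\<^sup>2 \<partial>M) < e"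
    using \<open>e > 0\<close> by (intro order_tendstoD) auto
  then obtain N where "(\<integral>x. (f x - clamp_real (real N) (f x))\<^sup>2 \<partial>M) < e"
    by (auto simp: eventually_sequentially)
  moreover have "integrable M (\<lambda>x. (f x - clamp_real (real N) (f x))\<^sup>2)"
    by (rule Bochner_Integration.integrable_bound[OF int meas]) (use le in auto)
  ultimately show ?thesis by (rule that)
qed

text \<open>
  A measurable function is almost everywhere a limit of continuous ones. Clamping these to the bound of
  the function and multiplying by the cutoffs keeps them bounded, so that dominated convergence
  applies on a set of finite measure.
\<close>

lemma bounded_function_L2_approx:
  fixes u :: "'a::euclidean_space \<Rightarrow> real"
  assumes \<Omega>: "\<Omega> \<in> lmeasurable" and u: "u \<in> borel_measurable (lebesgue_on \<Omega>)"
    and N: "\<And>x. \<bar>u x\<bar> \<le> N"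
    and h: "\<And>n. continuous_on UNIV (h n)" "\<And>n x. h n x \<in> {0..1}"
    and h1: "negligible Z" "\<And>x. x \<in> \<Omega> - Z \<Longrightarrow> (\<lambda>n. h n x) \<longlonglongrightarrow> (1::real)" and "e > 0"
  obtains g n where "continuous_on UNIV g"
    "(\<integral>x. (u x - g x * h n x)\<^sup>2 \<partial>lebesgue_on \<Omega>) < e"
    "integrable (lebesgue_on \<Omega>) (\<lambda>x. (u x - g x * h n x)\<^sup>2)"
proof -
  let ?M = "lebesgue_on \<Omega>"
  have \<Omega>s: "\<Omega> \<in> sets lebesgue" using \<Omega> by (rule fmeasurableD)
  interpret finite_measure ?M using \<Omega> by (rule finite_measure_lebesgue_on)
  have "N \<ge> 0" using N[of undefined] by auto
  let ?u0 = "\<lambda>x. if x \<in> \<Omega> then u x else 0"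
  have "?u0 \<in> borel_measurable lebesgue"
    using u \<Omega>s by (simp add: borel_measurable_if)
  then have "?u0 measurable_on UNIV"
    by (rule lebesgue_measurable_imp_measurable_on) simp
  then obtain Y G where Y: "negligible Y" and G: "\<And>n::nat. continuous_on UNIV (G n)"
    and lim: "\<And>x. x \<notin> Y \<Longrightarrow> (\<lambda>n. G n x) \<longlonglongrightarrow> ?u0 x"
    unfolding measurable_on_def by auto
  define w where "w n x = clamp_real N (G n x) * h n x" for n x
  have w_cont: "continuous_on UNIV (w n)" for n
    unfolding w_def by (intro continuous_intros continuous_on_clamp_real G h)
  have [measurable]: "w n \<in> borel_measurable ?M" for n
    using continuous_imp_measurable_on_sets_lebesgue[OF continuous_on_subset[OF w_cont] \<Omega>s] by simp
  note [measurable] = u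
  have w_le: "\<bar>w n x\<bar> \<le> N" for n x
  proof -
    have "\<bar>w n x\<bar> \<le> N * 1"
      unfolding w_def abs_mult using clamp_real_le[OF \<open>N \<ge> 0\<close>, of "G n x"] h(2)[of n x] \<open>N \<ge> 0\<close>
      by (intro mult_mono) auto
    then show ?thesis by simp
  qed
  have le: "norm ((u x - w n x)\<^sup>2) \<le> (2 * N)\<^sup>2" for n x
  proof -
    have "\<bar>u x - w n x\<bar> \<le> \<bar>2 * N\<bar>" using N[of x] w_le[of n x] by linarith
    then have "(u x - w n x)\<^sup>2 \<le> (2 * N)\<^sup>2" by (simp only: abs_le_square_iff)
    then show ?thesis by simp
  qed
  have int_const: "integrable ?M (\<lambda>x. (2 * N)\<^sup>2)" by simp
  have lim0: "AE x in ?M. (\<lambda>n. (u x - w n x)\<^sup>2) \<longlonglongrightarrow> 0"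
  proof -
    have "negligible (Y \<union> Z)" using Y h1(1) by (rule negligible_Un)
    then have "AE x in lebesgue. x \<notin> Y \<union> Z"
      by (intro AE_not_in) (simp only: negligible_iff_null_sets)
    then have "AE x in ?M. x \<notin> Y \<union> Z"
      using \<Omega>s by (subst AE_restrict_space_iff) (auto elim: eventually_mono)
    then show ?thesis
      using AE_space[of ?M]
    proof eventually_elim
      case (elim x)
      then have x: "x \<in> \<Omega>" "x \<notin> Y" "x \<notin> Z" by (auto simp: space_restrict_space)
      then have "(\<lambda>n. G n x) \<longlonglongrightarrow> u x" using lim[of x] by simp
      then have "(\<lambda>n. clamp_real N (G n x)) \<longlonglongrightarrow> clamp_real N (u x)"
        unfolding clamp_real_def by (intro tendsto_intros)
      moreover have "clamp_real N (u x) = u x" using N[of x] by (auto simp: clamp_real_def)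
      ultimately have "(\<lambda>n. w n x) \<longlonglongrightarrow> u x * 1"
        unfolding w_def using h1(2) x by (intro tendsto_mult) auto
      then have "(\<lambda>n. (u x - w n x)\<^sup>2) \<longlonglongrightarrow> (u x - u x * 1)\<^sup>2" by (intro tendsto_intros)
      then show ?case by simp
    qed
  qed
  have "(\<lambda>n. \<integral>x. (u x - w n x)\<^sup>2 \<partial>?M) \<longlonglongrightarrow> (\<integral>x. 0 \<partial>?M)"
    by (rule integral_dominated_convergence[OF _ _ int_const lim0]) (use le in auto)
  then have "\<forall>\<^sub>F n in sequentially. (\<integral>x. (u x - w n x)\<^sup>2 \<partial>?M) < e"
    using \<open>e > 0\<close> by (intro order_tendstoD) auto
  then obtain n where n: "(\<integral>x. (u x - w n x)\<^sup>2 \<partial>?M) < e"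
    by (auto simp: eventually_sequentially)
  have "integrable ?M (\<lambda>x. (u x - w n x)\<^sup>2)"
    by (rule Bochner_Integration.integrable_bound[OF int_const]) (use le[of _ n] in auto)
  with n show ?thesis
    using that[of "\<lambda>x. clamp_real N (G n x)" n] continuous_on_clamp_real[OF G]
    unfolding w_def by blast
qed

text \<open>
  An \<open>L\<^sup>2\<close> function is truncated, the truncation is approximated by \<open>g h\<^sub>n\<close> with \<open>g\<close> continuous, and
  \<open>g h\<^sub>n\<close> is approximated uniformly by members of \<open>F\<close>. The cutoffs \<open>h\<^sub>n\<close> allow for uniform closures that
  contain only functions with prescribed behaviour on a null set, such as periodic functions.
\<close>

lemma L2_dense_of_uniform_closure:
  fixes F :: "('a::euclidean_space \<Rightarrow> real) set"
  assumes \<Omega>: "\<Omega> \<in> lmeasurable" and S: "compact S" "\<Omega> \<subseteq> S"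
    and F: "\<And>f. f \<in> F \<Longrightarrow> continuous_on S f"
    and h: "\<And>n. continuous_on UNIV (h n)" "\<And>n x. h n x \<in> {0..1}"
    and h1: "negligible Z" "\<And>x. x \<in> \<Omega> - Z \<Longrightarrow> (\<lambda>n. h n x) \<longlonglongrightarrow> (1::real)"
    and dense: "\<And>g n. continuous_on UNIV g \<Longrightarrow> (\<lambda>x. g x * h n x) \<in> uniform_closure S F"
  shows "L2_dense (lebesgue_on \<Omega>) F"
proof -
  let ?M = "lebesgue_on \<Omega>"
  have \<Omega>s: "\<Omega> \<in> sets lebesgue" using \<Omega> by (rule fmeasurableD)
  interpret finite_measure ?M using \<Omega> by (rule finite_measure_lebesgue_on)
  have meas: "f \<in> borel_measurable ?M" if "continuous_on S f" for f :: "'a \<Rightarrow> real"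
    using continuous_imp_measurable_on_sets_lebesgue[OF continuous_on_subset[OF that S(2)] \<Omega>s] .
  have bdd: "integrable ?M f" if "continuous_on S f" for f :: "'a \<Rightarrow> real"
  proof -
    have "bounded (f ` S)" using that S by (intro compact_imp_bounded compact_continuous_image)
    then obtain B where "\<And>x. x \<in> S \<Longrightarrow> norm (f x) \<le> B" unfolding bounded_iff by auto
    then show ?thesis
      using meas[OF that] S(2)
      by (intro integrable_const_bound[of _ B]) (auto intro!: AE_I2)
  qed
  have sub: "F \<subseteq> L2_space ?M"
    using meas F bdd[OF continuous_on_power[OF F]] by (auto simp: L2_space_def)
  have "\<exists>k\<in>F. L2_dist ?M f k < \<epsilon>" if f: "f \<in> L2_space ?M" and "\<epsilon> > 0" for f \<epsilon>
  proof -
    \<comment> \<open>Three approximation steps, and the square of a sum of three terms is at most three times the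
      sum of their squares.\<close>
    define e where "e = \<epsilon>\<^sup>2 / 9"
    have e: "e > 0" using \<open>\<epsilon> > 0\<close> by (simp add: e_def)
    have [measurable]: "f \<in> borel_measurable ?M" using f by (simp add: L2_space_def)
    obtain N :: nat where N: "(\<integral>x. (f x - clamp_real N (f x))\<^sup>2 \<partial>?M) < e"
      "integrable ?M (\<lambda>x. (f x - clamp_real N (f x))\<^sup>2)"
      using L2_truncation[OF f e] by blast
    let ?u = "\<lambda>x. clamp_real N (f x)"
    have "?u \<in> borel_measurable ?M" unfolding clamp_real_def by measurable
    then obtain g n where g: "continuous_on UNIV g"
      and gn: "(\<integral>x. (?u x - g x * h n x)\<^sup>2 \<partial>?M) < e" "integrable ?M (\<lambda>x. (?u x - g x * h n x)\<^sup>2)"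
      using bounded_function_L2_approx[OF \<Omega> _ clamp_real_le h h1 e, of N f] by auto
    define w where "w x = g x * h n x" for x
    define d where "d = sqrt (e / (measure ?M \<Omega> + 1))"
    have d: "d > 0" "d\<^sup>2 * measure ?M \<Omega> < e"
    proof -
      have m: "0 < measure ?M \<Omega> + 1" by (simp add: add_nonneg_pos)
      then show "d > 0" using e by (simp add: d_def)
      have "d\<^sup>2 * measure ?M \<Omega> = e * (measure ?M \<Omega> / (measure ?M \<Omega> + 1))"
        using e m by (simp add: d_def)
      also have "\<dots> < e * 1" using e m by (intro mult_strict_left_mono) auto
      finally show "d\<^sup>2 * measure ?M \<Omega> < e" by simp
    qed
    obtain k where k: "k \<in> F" "\<And>x. x \<in> S \<Longrightarrow> \<bar>w x - k x\<bar> < d"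
      using uniform_closureD[OF dense[OF g, of n] d(1)] unfolding w_def by blast
    have wk_cont: "continuous_on S (\<lambda>x. (w x - k x)\<^sup>2)"
      unfolding w_def using F[OF k(1)] g h(1)[of n] continuous_on_subset[OF _ subset_UNIV]
      by (intro continuous_intros) blast+
    have wk: "integrable ?M (\<lambda>x. (w x - k x)\<^sup>2)" by (rule bdd[OF wk_cont])
    have "(\<integral>x. (w x - k x)\<^sup>2 \<partial>?M) \<le> (\<integral>x. d\<^sup>2 \<partial>?M)"
    proof (rule integral_mono[OF wk])
      fix x assume "x \<in> space ?M"
      then have "\<bar>w x - k x\<bar> \<le> \<bar>d\<bar>" using k(2)[of x] S(2) by fastforce
      then show "(w x - k x)\<^sup>2 \<le> d\<^sup>2" by (simp only: abs_le_square_iff)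
    qed simp
    also have "\<dots> < e" using d(2) by (simp add: mult.commute)
    finally have wk_e: "(\<integral>x. (w x - k x)\<^sup>2 \<partial>?M) < e" .
    let ?sum = "\<lambda>x. 3 * ((f x - ?u x)\<^sup>2 + (?u x - w x)\<^sup>2 + (w x - k x)\<^sup>2)"
    have int_sum: "integrable ?M ?sum"
      using N(2) gn(2) wk unfolding w_def by (intro integrable_mult_right Bochner_Integration.integrable_add) auto
    have le: "(f x - k x)\<^sup>2 \<le> ?sum x" for x
    proof -
      have "(a + b + c)\<^sup>2 \<le> 3 * (a\<^sup>2 + b\<^sup>2 + c\<^sup>2)" for a b c :: real
      proof -
        have "0 \<le> (a - b)\<^sup>2 + (b - c)\<^sup>2 + (a - c)\<^sup>2" by simp
        then show ?thesis by (simp add: power2_eq_square algebra_simps)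
      qed
      from this[of "f x - ?u x" "?u x - w x" "w x - k x"] show ?thesis by simp
    qed
    have [measurable]: "k \<in> borel_measurable ?M" using meas F k(1) by blast
    have "integrable ?M (\<lambda>x. (f x - k x)\<^sup>2)"
      by (rule Bochner_Integration.integrable_bound[OF int_sum]) (use le in \<open>auto intro!: AE_I2 intro: order_trans\<close>)
    then have "(\<integral>x. (f x - k x)\<^sup>2 \<partial>?M) \<le> integral\<^sup>L ?M ?sum"
      using le by (intro integral_mono[OF _ int_sum])
    also have "\<dots> = 3 * ((\<integral>x. (f x - ?u x)\<^sup>2 \<partial>?M) + (\<integral>x. (?u x - w x)\<^sup>2 \<partial>?M) + (\<integral>x. (w x - k x)\<^sup>2 \<partial>?M))"
      using N(2) gn(2) wk unfolding w_def by simp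
    also have "\<dots> < 3 * (e + e + e)" using N(1) gn(1) wk_e unfolding w_def by simp
    also have "\<dots> = \<epsilon>\<^sup>2" by (simp add: e_def)
    finally have "L2_dist ?M f k < sqrt (\<epsilon>\<^sup>2)" unfolding L2_dist_def by (rule real_sqrt_less_mono)
    then show ?thesis using k(1) \<open>\<epsilon> > 0\<close> by auto
  qed
  with sub show ?thesis unfolding L2_dense_def by blast
qed

section \<open>Independent samples hit every open set\<close>

text \<open>
  The probability that the first \<open>n\<close> samples all miss \<open>b\<close> is \<open>(1 - \<nu>(b))\<^sup>n\<close>.
\<close>

lemma iid_hits:
  assumes P: "prob_space P" and iid: "iid_samples P \<nu> X" and b: "b \<in> sets \<nu>" "0 < emeasure \<nu> b"
  shows "AE \<omega> in P. \<exists>j\<ge>1. X j \<omega> \<in> b"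
proof -
  interpret prob_space P by fact
  have indep: "indep_vars (\<lambda>_. \<nu>) X {1..}" and distr: "\<And>j. j \<ge> 1 \<Longrightarrow> distr P \<nu> (X j) = \<nu>"
    using iid by (auto simp: iid_samples_def)
  have rv: "X j \<in> measurable P \<nu>" if "j \<ge> 1" for j
    using indep that unfolding indep_vars_def by auto
  have sets: "indep_sets (\<lambda>i. {X i -` A \<inter> space P |A. A \<in> sets \<nu>}) {1..}"
    using indep unfolding indep_vars_def2 by auto
  interpret \<nu>: prob_space \<nu>
    using prob_space_distr[OF rv, of 1] distr[of 1] by simp
  define q where "q = measure \<nu> (space \<nu> - b)"
  have q: "0 \<le> q" "q < 1"
    using b \<nu>.prob_compl[OF b(1)] unfolding q_def by (auto simp: \<nu>.emeasure_eq_measure)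
  define miss where "miss j = X j -` (space \<nu> - b) \<inter> space P" for j
  have ev: "miss j \<in> events" if "j \<ge> 1" for j
    unfolding miss_def using rv[OF that] b(1) by auto
  have miss: "prob (miss j) = q" if "j \<ge> 1" for j
    using measure_distr[OF rv[OF that], of "space \<nu> - b"] b(1) distr[OF that]
    by (simp add: q_def miss_def)
  define Z where "Z = (\<Inter>j\<in>{1..}. miss j)"
  have Z: "Z \<in> events" unfolding Z_def using ev by (intro sets.countable_INT') auto
  have "prob Z \<le> q ^ Suc n" for n
  proof -
    have "prob Z \<le> prob (\<Inter>j\<in>{1..Suc n}. miss j)"
      unfolding Z_def using ev by (intro finite_measure_mono sets.finite_INT) auto
    also have "\<dots> = (\<Prod>j\<in>{1..Suc n}. prob (miss j))"
      by (rule indep_setsD[OF sets]) (use b(1) in \<open>auto simp: miss_def\<close>)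
    also have "\<dots> = q ^ Suc n" using miss by simp
    finally show ?thesis .
  qed
  moreover have "(\<lambda>n. q ^ Suc n) \<longlonglongrightarrow> 0"
    using q by (intro LIMSEQ_Suc LIMSEQ_power_zero) auto
  ultimately have "prob Z \<le> 0" by (intro LIMSEQ_le_const) auto
  then have "Z \<in> null_sets P" using Z by (auto simp: null_sets_def emeasure_eq_measure measure_le_0_iff)
  then show ?thesis
  proof (rule AE_I')
    show "{\<omega> \<in> space P. \<not> (\<exists>j\<ge>1. X j \<omega> \<in> b)} \<subseteq> Z"
      using measurable_space[OF rv] by (auto simp: Z_def miss_def)
  qed
qed

lemma iid_hits_every_open:
  fixes X :: "nat \<Rightarrow> 'w \<Rightarrow> 'b::second_countable_topology"
  assumes P: "prob_space P" and iid: "iid_samples P \<nu> X"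
    and pos: "\<And>b. open b \<Longrightarrow> b \<noteq> {} \<Longrightarrow> b \<subseteq> W \<Longrightarrow> b \<in> sets \<nu> \<and> 0 < emeasure \<nu> b"
  shows "AE \<omega> in P. \<forall>b. open b \<longrightarrow> b \<noteq> {} \<longrightarrow> b \<subseteq> W \<longrightarrow> (\<exists>j\<ge>1. X j \<omega> \<in> b)"
proof -
  obtain \<B> :: "'b set set" where \<B>: "countable \<B>" "topological_basis \<B>"
    using ex_countable_basis by blast
  have "AE \<omega> in P. \<forall>b\<in>{b\<in>\<B>. b \<noteq> {} \<and> b \<subseteq> W}. \<exists>j\<ge>1. X j \<omega> \<in> b"
  proof (rule AE_ball_countable')
    show "countable {b\<in>\<B>. b \<noteq> {} \<and> b \<subseteq> W}" using \<B>(1) by simp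
    show "AE \<omega> in P. \<exists>j\<ge>1. X j \<omega> \<in> b" if "b \<in> {b\<in>\<B>. b \<noteq> {} \<and> b \<subseteq> W}" for b
      using pos[of b] that topological_basis_open[OF \<B>(2)] by (intro iid_hits[OF P iid]) auto
  qed
  then show ?thesis
  proof eventually_elim
    case (elim \<omega>)
    show ?case
    proof (intro allI impI)
      fix b assume b: "open b" "b \<noteq> {}" "b \<subseteq> W"
      then obtain x where "x \<in> b" by blast
      then obtain b' where "b' \<in> \<B>" "x \<in> b'" "b' \<subseteq> b"
        using topological_basisE[OF \<B>(2) b(1)] by blast
      then show "\<exists>j\<ge>1. X j \<omega> \<in> b" using elim b by blast
    qed
  qed
qed


lemma full_support_open:
  assumes "full_support_prob T \<nu>" "openin T b" "b \<noteq> {}"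
  shows "b \<in> sets \<nu> \<and> 0 < emeasure \<nu> b"
  using assms unfolding full_support_prob_def by (auto intro: sigma_sets.Basic)

lemma iid_sample_in_space:
  assumes "prob_space P" "iid_samples P \<nu> X" "\<omega> \<in> space P" "j \<ge> 1"
  shows "X j \<omega> \<in> space \<nu>"
proof -
  interpret prob_space P by fact
  have "X j \<in> measurable P \<nu>"
    using assms unfolding iid_samples_def indep_vars_def by auto
  then show ?thesis using assms(3) by (rule measurable_space)
qed


section \<open>Geometry of the periodic cell\<close>

text \<open>
  The preimage under \<open>wrap\<close> of a set inside the cell is the union of its lattice translates.
\<close>

lemma openin_torus_topology_of_open:
  fixes a L :: "real ^ 'n"
  assumes L: "\<And>l. 0 < L $ l" and A: "open A" "A \<subseteq> cell a L"
  shows "openin (torus_topology a L) A"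
proof -
  have "wrap a L -` A = (\<Union>k. (\<lambda>x. x + lattice_shift L k) -` A)"
  proof (intro equalityI subsetI)
    fix x assume "x \<in> wrap a L -` A"
    moreover obtain k :: "int ^ 'n" where "wrap a L x = x + lattice_shift L k"
      using wrap_cong_lattice[OF L, of a x] unfolding lattice_shift_def by blast
    ultimately show "x \<in> (\<Union>k. (\<lambda>x. x + lattice_shift L k) -` A)" by auto
  next
    fix x assume "x \<in> (\<Union>k. (\<lambda>x. x + lattice_shift L k) -` A)"
    then obtain k where k: "x + lattice_shift L k \<in> A" by auto
    have "wrap a L x $ l = (x + lattice_shift L k) $ l" for l
    proof -
      let ?t = "(x $ l - a $ l) / L $ l"
      have "a $ l \<le> x $ l + of_int (k $ l) * L $ l" "x $ l + of_int (k $ l) * L $ l < a $ l + L $ l"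
        using k A(2) by (auto simp: cell_def lattice_shift_def)
      then have "0 \<le> ?t + of_int (k $ l)" "?t + of_int (k $ l) < 1"
        using L[of l] by (simp_all add: field_simps)
      then have "frac ?t = ?t + of_int (k $ l)"
        by (subst frac_unique_iff) auto
      then show ?thesis using L[of l] by (simp add: wrap_def lattice_shift_def field_simps)
    qed
    then have "wrap a L x = x + lattice_shift L k" by (simp add: vec_eq_iff)
    with k show "x \<in> wrap a L -` A" by simp
  qed
  moreover have "open ((\<lambda>x. x + lattice_shift L k) -` A)" for k
    by (intro open_vimage A continuous_intros)
  ultimately show ?thesis using A by (auto simp: openin_torus_topology)
qed

lemma box_subset_cell: "box a (a + L) \<subseteq> cell a L"
  by (auto simp: cell_def mem_box_cart less_imp_le)

lemma cell_subset_cbox: "cell a L \<subseteq> cbox a (a + L)"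
  by (auto simp: cell_def mem_box_cart less_imp_le)

lemma cell_box_nonempty:
  fixes a L :: "real ^ 'n"
  assumes "\<And>l. 0 < L $ l"
  shows "box a (a + L) \<noteq> {}"
proof -
  have "a + (1/2) *\<^sub>R L \<in> box a (a + L)" using assms by (auto simp: mem_box_cart)
  then show ?thesis by blast
qed

lemma closure_cell:
  fixes a L :: "real ^ 'n"
  assumes "\<And>l. 0 < L $ l"
  shows "closure (cell a L) = cbox a (a + L)"
proof
  show "closure (cell a L) \<subseteq> cbox a (a + L)"
    using cell_subset_cbox closed_cbox by (rule closure_minimal)
  show "cbox a (a + L) \<subseteq> closure (cell a L)"
    using closure_mono[OF box_subset_cell] closure_box[OF cell_box_nonempty[OF assms]] by metis
qed

lemma lmeasurable_cell: "cell a L \<in> lmeasurable"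
proof -
  have "cell a L = (\<Inter>l. {x. a $ l \<le> x $ l} \<inter> {x. x $ l < a $ l + L $ l})"
    by (auto simp: cell_def)
  also have "\<dots> \<in> sets borel"
    by (intro sets.countable_INT' sets.Int borel_closed borel_open)
       (auto intro!: closed_Collect_le open_Collect_less continuous_intros)
  finally have "cell a L \<in> sets lebesgue" by simp
  then show ?thesis
    using bounded_subset[OF bounded_cbox cell_subset_cbox] bounded_set_imp_lmeasurable by blast
qed

lemma openin_torus_product_of_open:
  fixes a L :: "real ^ 'n" and s t :: real
  assumes L: "\<And>l. 0 < L $ l" and b: "open b" "b \<subseteq> box a (a + L) \<times> {s<..<t}"
  shows "openin (prod_topology (torus_topology a L) (top_of_set {s..t})) b"
  unfolding openin_prod_topology_alt
proof (intro allI impI)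
  fix x y assume "(x, y) \<in> b"
  then obtain A B where AB: "open A" "open B" "(x, y) \<in> A \<times> B" "A \<times> B \<subseteq> b"
    using open_prod_elim[OF b(1)] by metis
  have "A \<times> B \<subseteq> box a (a + L) \<times> {s<..<t}" using AB(4) b(2) by (rule subset_trans)
  then have "A \<subseteq> box a (a + L)" "B \<subseteq> {s<..<t}" using AB(3) by (auto simp: times_subset_iff)
  then have "A \<subseteq> cell a L" "B \<subseteq> {s..t}"
    using box_subset_cell by (blast, auto simp: subset_iff)
  then have "openin (torus_topology a L) A" "openin (top_of_set {s..t}) B"
    using AB L openin_torus_topology_of_open[of L A a] openin_open_Int[of B "{s..t}"]
    by (simp_all add: inf.absorb2)
  then show "\<exists>U V. openin (torus_topology a L) U \<and> openin (top_of_set {s..t}) V \<and>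
      x \<in> U \<and> y \<in> V \<and> U \<times> V \<subseteq> b"
    using AB(3,4) by blast
qed


section \<open>Density for parameters that hit every open set\<close>

lemma lincomb_closed_continuous_on: "lincomb_closed {f. continuous_on S f}"
  unfolding lincomb_closed_def
  by (auto intro!: continuous_intros exI[of _ "\<lambda>_. 0"])

lemma lincomb_closed_periodic: "lincomb_closed {f :: _ \<Rightarrow> real. \<forall>x k. f (x + lattice_shift L k) = f x}"
  unfolding lincomb_closed_def by (auto intro!: exI[of _ "\<lambda>_. 0"])

lemma gaussian_features_dense:
  fixes \<Omega> :: "(real ^ 'n) set" and \<theta> :: "nat \<Rightarrow> (real ^ 'n) \<times> real"
  assumes \<Omega>: "compact \<Omega>" "interior \<Omega> \<noteq> {}" and \<sigma>: "0 < \<sigma>min" "\<sigma>min < \<sigma>max"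
    and pos: "\<And>j. j \<ge> 1 \<Longrightarrow> 0 < snd (\<theta> j)"
    and hit: "\<And>b. open b \<Longrightarrow> b \<noteq> {} \<Longrightarrow> b \<subseteq> interior \<Omega> \<times> {\<sigma>min<..<\<sigma>max} \<Longrightarrow> \<exists>j\<ge>1. \<theta> j \<in> b"
  defines "F \<equiv> RF_union (\<lambda>j. gaussian_feature (\<theta> j))"
  shows "sup_closure \<Omega> (C_space \<Omega>) F = mspace (C_space \<Omega>)" "L2_dense (lebesgue_on \<Omega>) F"
proof -
  define L :: "real ^ 'n" where "L = (\<chi> l. 1)"
  have L: "0 < L $ l" for l by (simp add: L_def)
  note G = lattice_gauss_zero[of L]
  have F_cont: "continuous_on \<Omega> f" if "f \<in> F" for f
  proof -
    have "F \<subseteq> {f. continuous_on \<Omega> f}"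
      unfolding F_def G[symmetric]
      by (intro RF_union_subset lincomb_closed_continuous_on CollectI lattice_gauss_continuous L
          pos compact_imp_bounded \<Omega>)
    with that show ?thesis by blast
  qed
  have dense: "f \<in> uniform_closure \<Omega> F" if f: "continuous_on \<Omega> f" for f
  proof (rule lattice_gauss_span_dense[where K = "{0}" and L = L, OF L \<sigma> _ \<Omega>(1) open_interior \<Omega>(2)])
    show "lincomb_closed F" unfolding F_def by (rule lincomb_closed_RF_union)
    show "\<exists>\<theta>\<in>b. lattice_gauss {0} L \<theta> \<in> F"
      if "open b" "b \<noteq> {}" "b \<subseteq> interior \<Omega> \<times> {\<sigma>min<..<\<sigma>max}" for b
      using hit[OF that] feature_in_RF_union[of _ "\<lambda>j. gaussian_feature (\<theta> j)"]
      unfolding F_def G by blast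
    show "(\<lambda>x. f x / lattice_gauss {0} L \<theta> x) \<in> uniform_closure \<Omega> (trig_poly (dual_lattice {0} L))"
      if "0 < snd \<theta>" for \<theta>
      using lattice_gauss_pos[OF L that, of "{0}"] f
      by (intro trig_poly_dense \<Omega> continuous_on_divide lattice_gauss_continuous L that compact_imp_bounded)
         (auto simp: less_imp_neq[symmetric])
  qed simp
  have "sup_closure \<Omega> (submetric (C_space \<Omega>) UNIV) F = mspace (submetric (C_space \<Omega>) UNIV)"
    using F_cont dense by (intro sup_closure_eq_mspace \<Omega>) auto
  then show "sup_closure \<Omega> (C_space \<Omega>) F = mspace (C_space \<Omega>)" by simp
  show "L2_dense (lebesgue_on \<Omega>) F"
  proof (rule L2_dense_of_uniform_closure[where h = "\<lambda>_ _. 1" and Z = "{}"])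
    show "\<Omega> \<in> lmeasurable" by (rule lmeasurable_compact[OF \<Omega>(1)])
    show "(\<lambda>x. g x * 1) \<in> uniform_closure \<Omega> F" if "continuous_on UNIV g" for g
      using dense[of g] continuous_on_subset[OF that] by simp
  qed (use \<Omega> F_cont in auto)
qed

text \<open>
  Two points of the closed cell that differ by a lattice vector differ in each coordinate by \<open>0\<close> or
  \<open>\<plusminus>L\<^sub>l\<close>. The coordinates are changed one at a time; the intermediate points \<open>z A\<close> stay in the cell, and
  each change moves between opposite faces.
\<close>

lemma face_periodic_imp_lattice_periodic:
  fixes a L :: "real ^ 'n"
  assumes L: "\<And>l. 0 < L $ l"
    and face: "\<And>x l. x \<in> cbox a (a + L) \<Longrightarrow> x + axis l (L $ l) \<in> cbox a (a + L) \<Longrightarrow> f (x + axis l (L $ l)) = f x"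
    and x: "x \<in> cbox a (a + L)" "x + lattice_shift L k \<in> cbox a (a + L)"
  shows "f (x + lattice_shift L k) = f x"
proof -
  define z where "z A = (\<chi> l. if l \<in> A then x $ l + of_int (k $ l) * L $ l else x $ l)" for A
  have z_in: "z A \<in> cbox a (a + L)" for A
    using x by (auto simp: z_def mem_box_cart lattice_shift_def)
  have "f (z A) = f x" if "finite A" for A
    using that
  proof induction
    case empty
    have "z {} = x" by (simp add: z_def vec_eq_iff)
    then show ?case by simp
  next
    case (insert l A)
    have shift: "z (insert l A) = z A + axis l (of_int (k $ l) * L $ l)"
      using \<open>l \<notin> A\<close> by (auto simp: z_def vec_eq_iff axis_def)
    have "a $ l \<le> x $ l" "x $ l \<le> a $ l + L $ l" "a $ l \<le> x $ l + of_int (k $ l) * L $ l"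
       "x $ l + of_int (k $ l) * L $ l \<le> a $ l + L $ l"
      using x by (auto simp: mem_box_cart lattice_shift_def)
    then have "of_int (k $ l) * L $ l \<le> 1 * L $ l" "(-1) * L $ l \<le> of_int (k $ l) * L $ l" by linarith+
    then have "of_int (k $ l) \<le> (1 :: real)" "-1 \<le> (of_int (k $ l) :: real)"
      using L[of l] by (simp_all only: mult_le_cancel_right_pos)
    then consider "k $ l = 0" | "k $ l = 1" | "k $ l = -1" by linarith
    then have "f (z (insert l A)) = f (z A)"
    proof cases
      case 1
      then have "z (insert l A) = z A" using shift by (simp add: axis_def vec_eq_iff)
      then show ?thesis by simp
    next
      case 2
      then show ?thesis using face[of "z A" l] z_in[of A] z_in[of "insert l A"] shift by simp
    next
      case 3
      then have "z A = z (insert l A) + axis l (L $ l)"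
        using shift by (simp add: axis_def vec_eq_iff)
      then show ?thesis using face[of "z (insert l A)" l] z_in[of A] z_in[of "insert l A"] by simp
    qed
    with insert.IH show ?case by simp
  qed
  moreover have "z UNIV = x + lattice_shift L k" by (simp add: z_def vec_eq_iff lattice_shift_def)
  ultimately show ?thesis by (metis finite_class.finite_UNIV)
qed

definition interior_cutoff :: "'a::euclidean_space set \<Rightarrow> nat \<Rightarrow> 'a \<Rightarrow> real" where
  "interior_cutoff B n x = min 1 (real n * infdist x (- B))"

lemma interior_cutoff_range: "interior_cutoff B n x \<in> {0..1}"
  by (simp add: interior_cutoff_def infdist_nonneg)

lemma continuous_on_interior_cutoff: "continuous_on A (interior_cutoff B n)"
  unfolding interior_cutoff_def[abs_def] by (intro continuous_intros)

lemma interior_cutoff_outside: "x \<notin> B \<Longrightarrow> interior_cutoff B n x = 0"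
  by (simp add: interior_cutoff_def)

lemma interior_cutoff_tendsto:
  assumes "open B" "B \<noteq> UNIV" "x \<in> B"
  shows "(\<lambda>n. interior_cutoff B n x) \<longlonglongrightarrow> 1"
proof (rule tendsto_eventually)
  have "infdist x (- B) > 0"
    using assms by (intro infdist_pos_not_in_closed) auto
  then obtain N :: nat where N: "1 \<le> real N * infdist x (- B)"
    using ex_less_of_nat_mult less_imp_le by blast
  have "interior_cutoff B n x = 1" if "n \<ge> N" for n
  proof -
    have "real N * infdist x (- B) \<le> real n * infdist x (- B)"
      using that by (intro mult_right_mono) (auto simp: infdist_nonneg)
    with N show ?thesis by (simp add: interior_cutoff_def)
  qed
  then show "\<forall>\<^sub>F n in sequentially. interior_cutoff B n x = 1"
    by (auto simp: eventually_sequentially)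
qed

lemma periodic_gaussian_features_dense:
  fixes a L :: "real ^ 'n" and \<theta> :: "nat \<Rightarrow> (real ^ 'n) \<times> real"
  assumes L: "\<And>l. 0 < L $ l" and \<sigma>: "0 < \<sigma>min" "\<sigma>min < \<sigma>max"
    and pos: "\<And>j. j \<ge> 1 \<Longrightarrow> 0 < snd (\<theta> j)"
    and hit: "\<And>b. open b \<Longrightarrow> b \<noteq> {} \<Longrightarrow> b \<subseteq> box a (a + L) \<times> {\<sigma>min<..<\<sigma>max} \<Longrightarrow> \<exists>j\<ge>1. \<theta> j \<in> b"
  defines "F \<equiv> RF_union (\<lambda>j. periodic_gaussian_feature L (\<theta> j))"
  shows "sup_closure (closure (cell a L)) (C_per a L) F = mspace (C_per a L)"
    "L2_dense (lebesgue_on (cell a L)) F"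
proof -
  let ?S = "cbox a (a + L)"
  note G = lattice_gauss_UNIV[of L]
  have S: "compact ?S" by simp
  have per: "lattice_gauss UNIV L \<theta> (x + lattice_shift L k) = lattice_gauss UNIV L \<theta> x" for \<theta> x k
    using lattice_sum_shift[of L _ "x - fst \<theta>" k] by (simp add: lattice_gauss_def algebra_simps)
  have F_cont: "continuous_on ?S f" if "f \<in> F" for f
  proof -
    have "F \<subseteq> {f. continuous_on ?S f}"
      unfolding F_def G[symmetric]
      by (intro RF_union_subset lincomb_closed_continuous_on CollectI lattice_gauss_continuous L
          pos compact_imp_bounded S)
    with that show ?thesis by blast
  qed
  have F_per: "f (x + lattice_shift L k) = f x" if "f \<in> F" for f x k
  proof -
    have "F \<subseteq> {f. \<forall>x k. f (x + lattice_shift L k) = f x}"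
      unfolding F_def G[symmetric]
      by (intro RF_union_subset lincomb_closed_periodic CollectI allI per)
    with that show ?thesis by blast
  qed
  have dense: "f \<in> uniform_closure ?S F"
    if f: "continuous_on ?S f"
      and f_per: "\<And>x k. x \<in> ?S \<Longrightarrow> x + lattice_shift L k \<in> ?S \<Longrightarrow> f (x + lattice_shift L k) = f x" for f
  proof (rule lattice_gauss_span_dense[where K = UNIV and L = L, OF L \<sigma> _ S open_box cell_box_nonempty[OF L]])
    show "lincomb_closed F" unfolding F_def by (rule lincomb_closed_RF_union)
    show "\<exists>\<theta>\<in>b. lattice_gauss UNIV L \<theta> \<in> F"
      if "open b" "b \<noteq> {}" "b \<subseteq> box a (a + L) \<times> {\<sigma>min<..<\<sigma>max}" for b
      using hit[OF that] feature_in_RF_union[of _ "\<lambda>j. periodic_gaussian_feature L (\<theta> j)"]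
      unfolding F_def G by blast
    show "(\<lambda>x. f x / lattice_gauss UNIV L \<theta> x) \<in> uniform_closure ?S (trig_poly (dual_lattice UNIV L))"
      if "0 < snd \<theta>" for \<theta>
    proof (rule periodic_trig_poly_dense[OF L S])
      show "continuous_on ?S (\<lambda>x. f x / lattice_gauss UNIV L \<theta> x)"
        using lattice_gauss_pos[OF L that, of UNIV] f
        by (intro continuous_on_divide lattice_gauss_continuous L that compact_imp_bounded S)
           (auto simp: less_imp_neq[symmetric])
    qed (simp add: f_per per)
  qed simp
  define Q where "Q = {f :: real ^ 'n \<Rightarrow> real. \<forall>x l. x \<in> ?S \<longrightarrow> x + axis l (L $ l) \<in> ?S
            \<longrightarrow> f (x + axis l (L $ l)) = f x}"
  have axis: "axis l (L $ l) = lattice_shift L (axis l 1)" for l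
    by (auto simp: vec_eq_iff axis_def lattice_shift_def)
  have "sup_closure ?S (submetric (C_space ?S) Q) F = mspace (submetric (C_space ?S) Q)"
  proof (rule sup_closure_eq_mspace[OF S])
    show "continuous_on ?S f \<and> restrict f ?S \<in> Q" if "f \<in> F" for f
      using F_cont[OF that] F_per[OF that] by (auto simp: Q_def axis)
    show "f \<in> uniform_closure ?S F" if "f \<in> Q" "continuous_on ?S f" for f
      using that(1) face_periodic_imp_lattice_periodic[OF L, of a f]
      unfolding Q_def by (intro dense that) blast
  qed
  then show "sup_closure (closure (cell a L)) (C_per a L) F = mspace (C_per a L)"
    unfolding C_per_def closure_cell[OF L] Q_def .
  show "L2_dense (lebesgue_on (cell a L)) F"
  proof (rule L2_dense_of_uniform_closure[where h = "interior_cutoff (box a (a + L))" and Z = "?S - box a (a + L)"])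
    show "negligible (?S - box a (a + L))" by (rule negligible_frontier_interval)
    show "(\<lambda>n. interior_cutoff (box a (a + L)) n x) \<longlonglongrightarrow> 1" if "x \<in> cell a L - (?S - box a (a + L))" for x
    proof (rule interior_cutoff_tendsto[OF open_box])
      show "box a (a + L) \<noteq> UNIV" by (metis bounded_box not_bounded_UNIV)
      show "x \<in> box a (a + L)" using that cell_subset_cbox by blast
    qed
    show "(\<lambda>x. g x * interior_cutoff (box a (a + L)) n x) \<in> uniform_closure ?S F"
      if g: "continuous_on UNIV g" for g n
    proof (rule dense)
      show "continuous_on ?S (\<lambda>x. g x * interior_cutoff (box a (a + L)) n x)"
        by (intro continuous_on_mult continuous_on_interior_cutoff continuous_on_subset[OF g]) simp
      fix x k assume x: "x \<in> ?S" "x + lattice_shift L k \<in> ?S"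
      show "g (x + lattice_shift L k) * interior_cutoff (box a (a + L)) n (x + lattice_shift L k)
          = g x * interior_cutoff (box a (a + L)) n x"
      proof (cases "k = 0")
        case True
        then have "lattice_shift L k = 0" by (simp add: lattice_shift_def vec_eq_iff)
        then show ?thesis by simp
      next
        case False
        then obtain l where l: "k $ l \<noteq> 0" by (auto simp: vec_eq_iff)
        \<comment> \<open>Two distinct lattice-equivalent points of the closed cell both lie on its boundary, where the
          cutoff vanishes.\<close>
        have "L $ l \<le> \<bar>of_int (k $ l) * L $ l\<bar>"
          using l L[of l] by (simp add: abs_mult)
        moreover have "a $ l \<le> x $ l" "x $ l \<le> a $ l + L $ l"
          "a $ l \<le> x $ l + of_int (k $ l) * L $ l" "x $ l + of_int (k $ l) * L $ l \<le> a $ l + L $ l"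
          using x by (auto simp: mem_box_cart lattice_shift_def)
        ultimately have "\<not> (a $ l < x $ l \<and> x $ l < a $ l + L $ l)"
          "\<not> (a $ l < x $ l + of_int (k $ l) * L $ l \<and> x $ l + of_int (k $ l) * L $ l < a $ l + L $ l)"
          by linarith+
        then have "x \<notin> box a (a + L)" "x + lattice_shift L k \<notin> box a (a + L)"
          by (auto simp: mem_box_cart lattice_shift_def)
        then show ?thesis by (simp add: interior_cutoff_outside)
      qed
    qed
  qed (rule lmeasurable_cell S cell_subset_cbox F_cont interior_cutoff_range
        continuous_on_interior_cutoff; assumption?)+
qed


section \<open>Almost sure density\<close>

theorem lemma2:
  fixes \<sigma>min \<sigma>max :: real
    and P :: "'w measure"
    and \<nu> :: "((real ^ 'n) \<times> real) measure"
    and X :: "nat \<Rightarrow> 'w \<Rightarrow> (real ^ 'n) \<times> real"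
    and \<Omega> :: "(real ^ 'n) set"
    and a L :: "real ^ 'n"
  assumes "0 < \<sigma>min" and "\<sigma>min < \<sigma>max"
    and "prob_space P" and "iid_samples P \<nu> X"
  shows
    "((\<exists>U. open U \<and> connected U \<and> bounded U \<and> \<Omega> = closure U) \<and> interior \<Omega> \<noteq> {} \<and>
      full_support_prob (top_of_set (\<Omega> \<times> {\<sigma>min..\<sigma>max})) \<nu> \<longrightarrow>
        (AE \<omega> in P. sup_closure \<Omega> (C_space \<Omega>) (\<Union>M\<in>{1..}. V_RF (\<lambda>j. gaussian_feature (X j \<omega>)) M)
                    = mspace (C_space \<Omega>)) \<and>
        (AE \<omega> in P. L2_dense (lebesgue_on \<Omega>) (\<Union>M\<in>{1..}. V_RF (\<lambda>j. gaussian_feature (X j \<omega>)) M)))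
     \<and>
     ((\<forall>l. 0 < L $ l) \<and>
      full_support_prob (prod_topology (torus_topology a L) (top_of_set {\<sigma>min..\<sigma>max})) \<nu> \<longrightarrow>
        (AE \<omega> in P. sup_closure (closure (cell a L)) (C_per a L)
                      (\<Union>M\<in>{1..}. V_RF (\<lambda>j. periodic_gaussian_feature L (X j \<omega>)) M)
                    = mspace (C_per a L)) \<and>
        (AE \<omega> in P. L2_dense (lebesgue_on (cell a L))
                      (\<Union>M\<in>{1..}. V_RF (\<lambda>j. periodic_gaussian_feature L (X j \<omega>)) M)))"
  unfolding RF_union_def[symmetric]
proof (intro conjI[where P = "_ \<longrightarrow> _"] impI)
  assume A: "(\<exists>U. open U \<and> connected U \<and> bounded U \<and> \<Omega> = closure U) \<and> interior \<Omega> \<noteq> {} \<and>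
      full_support_prob (top_of_set (\<Omega> \<times> {\<sigma>min..\<sigma>max})) \<nu>"
  then have \<Omega>: "compact \<Omega>" by auto
  have fs: "full_support_prob (top_of_set (\<Omega> \<times> {\<sigma>min..\<sigma>max})) \<nu>" using A by blast
  have "AE \<omega> in P. \<forall>b. open b \<longrightarrow> b \<noteq> {} \<longrightarrow> b \<subseteq> interior \<Omega> \<times> {\<sigma>min<..<\<sigma>max} \<longrightarrow> (\<exists>j\<ge>1. X j \<omega> \<in> b)"
  proof (rule iid_hits_every_open[OF assms(3,4)])
    fix b :: "((real ^ 'n) \<times> real) set"
    assume b: "open b" "b \<noteq> {}" "b \<subseteq> interior \<Omega> \<times> {\<sigma>min<..<\<sigma>max}"
    have "b \<subseteq> \<Omega> \<times> {\<sigma>min..\<sigma>max}" using b(3) interior_subset[of \<Omega>] by fastforce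
    then have "openin (top_of_set (\<Omega> \<times> {\<sigma>min..\<sigma>max})) b"
      using b(1) by (metis inf.absorb_iff2 openin_open_Int)
    then show "b \<in> sets \<nu> \<and> 0 < emeasure \<nu> b" using full_support_open[OF fs] b(2) by blast
  qed
  then have "AE \<omega> in P. sup_closure \<Omega> (C_space \<Omega>) (RF_union (\<lambda>j. gaussian_feature (X j \<omega>)))
        = mspace (C_space \<Omega>) \<and> L2_dense (lebesgue_on \<Omega>) (RF_union (\<lambda>j. gaussian_feature (X j \<omega>)))"
    using AE_space
  proof eventually_elim
    case (elim \<omega>)
    have pos: "0 < snd (X j \<omega>)" if "j \<ge> 1" for j
    proof -
      have "X j \<omega> \<in> \<Omega> \<times> {\<sigma>min..\<sigma>max}"
        using iid_sample_in_space[OF assms(3,4) elim(2) that] fs by (simp add: full_support_prob_def)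
      then show ?thesis using assms(1) by (cases "X j \<omega>") auto
    qed
    show ?case
      using gaussian_features_dense[OF \<Omega> _ assms(1,2), of "\<lambda>j. X j \<omega>"] A pos elim(1) by blast
  qed
  then show "(AE \<omega> in P. sup_closure \<Omega> (C_space \<Omega>) (RF_union (\<lambda>j. gaussian_feature (X j \<omega>)))
                    = mspace (C_space \<Omega>)) \<and>
        (AE \<omega> in P. L2_dense (lebesgue_on \<Omega>) (RF_union (\<lambda>j. gaussian_feature (X j \<omega>))))"
    by simp
next
  assume A: "(\<forall>l. 0 < L $ l) \<and>
      full_support_prob (prod_topology (torus_topology a L) (top_of_set {\<sigma>min..\<sigma>max})) \<nu>"
  then have L: "\<And>l. 0 < L $ l"
    and fs: "full_support_prob (prod_topology (torus_topology a L) (top_of_set {\<sigma>min..\<sigma>max})) \<nu>" by auto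
  have "AE \<omega> in P. \<forall>b. open b \<longrightarrow> b \<noteq> {} \<longrightarrow> b \<subseteq> box a (a + L) \<times> {\<sigma>min<..<\<sigma>max} \<longrightarrow> (\<exists>j\<ge>1. X j \<omega> \<in> b)"
    by (rule iid_hits_every_open[OF assms(3,4)])
       (rule full_support_open[OF fs openin_torus_product_of_open[OF L]])
  then have "AE \<omega> in P. sup_closure (closure (cell a L)) (C_per a L) (RF_union (\<lambda>j. periodic_gaussian_feature L (X j \<omega>)))
        = mspace (C_per a L) \<and>
        L2_dense (lebesgue_on (cell a L)) (RF_union (\<lambda>j. periodic_gaussian_feature L (X j \<omega>)))"
    using AE_space
  proof eventually_elim
    case (elim \<omega>)
    have pos: "0 < snd (X j \<omega>)" if "j \<ge> 1" for j
    proof -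
      have "X j \<omega> \<in> cell a L \<times> {\<sigma>min..\<sigma>max}"
        using iid_sample_in_space[OF assms(3,4) elim(2) that] fs
        by (simp add: full_support_prob_def topspace_torus_topology[OF L])
      then show ?thesis using assms(1) by (cases "X j \<omega>") auto
    qed
    show ?case
      using periodic_gaussian_features_dense[OF L assms(1,2), of "\<lambda>j. X j \<omega>" a] pos elim(1) by blast
  qed
  then show "(AE \<omega> in P. sup_closure (closure (cell a L)) (C_per a L)
                      (RF_union (\<lambda>j. periodic_gaussian_feature L (X j \<omega>)))
                    = mspace (C_per a L)) \<and>
        (AE \<omega> in P. L2_dense (lebesgue_on (cell a L))
                      (RF_union (\<lambda>j. periodic_gaussian_feature L (X j \<omega>))))"
    by simp
qed

end
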